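(* For $n\in\{1,2\}$ let $$G(t_1,\dots,t_n)=\eta(q)\,\mathrm{tr}|_{\mathcal{F}_0}\,o(X(\psi,t_1x_1)X(\psi^*,x_1))\cdots o(X(\psi,t_nx_n)X(\psi^*,x_n))\,q^{\bar L(0)}.$$ Then, as formal series, $$G(qt_1,t_2)+q^{1/2}t_1t_2\,G(t_1,t_2)=\delta_{1/2}(qt_1)\,G(t_2)+q^{1/2}t_1t_2\,G(t_1t_2).$$ Moreover, $$(1-qt_1t_2)(1-qt_1)\left\{G(qt_1,t_2)+q^{1/2}t_1t_2\,G(t_1,t_2)-q^{1/2}t_1t_2\,G(t_1t_2)\right\}=0.$$
   Context: Charged free fermions: the Lie superalgebra with odd generators $\psi(n),\psi^*(n)$, $n\in\mathbb{Z}+\frac12$, and central $1$, with $[\psi(n),\psi^*(m)]=\delta_{m+n,0}$, $[\psi(n),\psi(m)]=[\psi^*(n),\psi^*(m)]=0$ (anticommutators). $\mathcal{F}$ is the Fock space generated from $\mathbf 1$ with $\psi(n)\mathbf 1=\psi^*(n)\mathbf 1=0$ for $n>0$, a vertex operator superalgebra of central charge $1$ with conformal vector $\omega=\frac12\psi^*(-3/2)\psi(-1/2)\mathbf 1+\frac12\psi(-3/2)\psi^*(-1/2)\mathbf 1$; $\mathcal{F}=\bigoplus_m\mathcal{F}_m$ is the charge decomposition ($\psi(n),\psi^*(n)$ have charges $1,-1$, $\mathbf 1$ has charge $0$). With $\psi=\psi(-1/2)\mathbf 1$, $\psi^*=\psi^*(-1/2)\mathbf 1$: $X(\psi,tx)=\sum_{n\in\mathbb{Z}+1/2}\psi(n)t^{-n}x^{-n}$,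 $X(\psi^*,x)=\sum_{n\in\mathbb{Z}+1/2}\psi^*(n)x^{-n}$; $o(X(\psi,tx)X(\psi^*,x))$ is the coefficient of $x^0$ in $X(\psi,tx)X(\psi^*,x)$. $\bar L(0)=L(0)-\frac1{24}$, $\eta(q)=q^{1/24}\prod_{n\ge1}(1-q^n)$, $\delta_{1/2}(t)=\sum_{n\in\mathbb{Z}+1/2}t^n$. All variables are formal; series have integral powers of $q^{\pm1/2}$ and $t_i^{\pm1/2}$. $G(t_1t_2)$ is the one-variable function evaluated at $t_1t_2$. *)

theory Defs
  imports
    "HOL-Library.Groups_Big_Fun"
    "HOL-Library.Function_Algebras"
    "HOL-Library.Product_Plus"
    "HOL-Library.FSet"
    "HOL-Library.Poly_Mapping"
    "HOL-Computational_Algebra.Formal_Power_Series"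
    "HOL-Analysis.Infinite_Products"
begin

section \<open>Formal series with rational exponents\<close>

text \<open>
  A formal series in \<open>q, t\<^sub>1, t\<^sub>2\<close> is its family of coefficients, and the triple
  \<open>(k, a, b)\<close> stands for the monomial \<open>q\<^sup>k t\<^sub>1\<^sup>a t\<^sub>2\<^sup>b\<close>; monomials are multiplied by adding
  exponents.  Sums of series are pointwise, whereas the product \<open>\<star>\<close> is the Cauchy product (not the
  pointwise \<open>*\<close> of function algebras).  \<^const>\<open>Sum_any\<close> is the sum over the finitely many
  non-zero terms, so \<open>f \<star> g\<close> is meaningful when each of its coefficients involves only finitely many
  non-zero products.
\<close>

type_synonym monomial = "rat \<times> rat \<times> rat"
type_synonym fseries = "monomial \<Rightarrow> complex"

definition fs_mult :: "fseries \<Rightarrow> fseries \<Rightarrow> fseries" (infixl \<open>\<star>\<close> 70) where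
  "(f \<star> g) e = Sum_any (\<lambda>d. f d * g (e - d))"

definition mono_fs :: "monomial \<Rightarrow> fseries" where
  "mono_fs d e = (if e = d then 1 else 0)"

definition scale_exp :: "rat \<Rightarrow> monomial \<Rightarrow> monomial" where
  "scale_exp r = (\<lambda>(k, a, b). (r * k, r * a, r * b))"

text \<open>
  An \<open>n\<close>-variable series with coefficients that are series in \<open>q\<close> is given by a function \<open>F\<close>, where
  \<open>F [a\<^sub>1, \<dots>, a\<^sub>n] k\<close> is the coefficient of \<open>z\<^sub>1\<^bsup>a\<^sub>1\<^esup> \<dots> z\<^sub>n\<^bsup>a\<^sub>n\<^esup> q\<^sup>k\<close>.  The following substitutes
  the monomials \<open>ms\<close> for \<open>z\<^sub>1, \<dots>, z\<^sub>n\<close>.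
\<close>

definition subst_fs :: "(rat list \<Rightarrow> rat \<Rightarrow> complex) \<Rightarrow> monomial list \<Rightarrow> fseries" where
  "subst_fs F ms e =
     Sum_any (\<lambda>(as, k). if length as = length ms \<and> (k, 0, 0) + sum_list (map2 scale_exp as ms) = e
                        then F as k else 0)"

definition half_ints :: "rat set" where
  "half_ints = {of_int k + 1/2 |k. True}"

definition delta_half_coeff :: "rat list \<Rightarrow> rat \<Rightarrow> complex" where
  "delta_half_coeff as k = (if as \<in> {[a] |a. a \<in> half_ints} \<and> k = 0 then 1 else 0)"

definition delta_half :: "monomial \<Rightarrow> fseries" where
  "delta_half m = subst_fs delta_half_coeff [m]"

text \<open>The coefficient of \<open>q\<^sup>r\<close> in \<open>\<eta>(q)\<close>; the infinite product is the limit of formal power series.\<close>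

definition eta_coeff :: "rat \<Rightarrow> complex" where
  "eta_coeff r = Sum_any (\<lambda>k::nat. if r = 1/24 + of_nat k
     then fps_nth (prodinf (\<lambda>n. 1 - fps_X ^ Suc n :: complex fps)) k else 0)"


section \<open>Charged free fermions and their Fock space\<close>

inductive_set charge_monomials ::
  "(rat \<Rightarrow> 'v \<Rightarrow> 'v) \<Rightarrow> (rat \<Rightarrow> 'v \<Rightarrow> 'v) \<Rightarrow> 'v \<Rightarrow> (int \<times> 'v) set"
  for psi psis vac where
    "(0, vac) \<in> charge_monomials psi psis vac"
  | "(m, v) \<in> charge_monomials psi psis vac \<Longrightarrow> n \<in> half_ints \<Longrightarrow>
       (m + 1, psi n v) \<in> charge_monomials psi psis vac"
  | "(m, v) \<in> charge_monomials psi psis vac \<Longrightarrow> n \<in> half_ints \<Longrightarrow>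
       (m - 1, psis n v) \<in> charge_monomials psi psis vac"

text \<open>
  The space \<open>\<F>\<close> is the whole type \<open>'v\<close>, the modes \<open>\<psi>(n)\<close> and \<open>\<psi>\<^sup>*(n)\<close> are \<open>psi n\<close> and \<open>psis n\<close>
  (only indices in \<^const>\<open>half_ints\<close> matter), and the central element acts as the identity.  A non-zero
  module generated by a vacuum vector is unique up to isomorphism, since the Fock module is
  irreducible; its existence is lemma \<open>charged_fermion_fock_exists\<close> below.
\<close>

locale charged_fermion_fock = vector_space scale
  for scale :: "complex \<Rightarrow> 'v::ab_group_add \<Rightarrow> 'v" +
  fixes psi psis :: "rat \<Rightarrow> 'v \<Rightarrow> 'v" and vac :: 'v
  assumes linear_psi: "n \<in> half_ints \<Longrightarrow> Vector_Spaces.linear scale scale (psi n)"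
    and linear_psis: "n \<in> half_ints \<Longrightarrow> Vector_Spaces.linear scale scale (psis n)"
    and psi_psis: "n \<in> half_ints \<Longrightarrow> m \<in> half_ints \<Longrightarrow>
          psi n (psis m v) + psis m (psi n v) = (if m + n = 0 then v else 0)"
    and psi_psi: "n \<in> half_ints \<Longrightarrow> m \<in> half_ints \<Longrightarrow> psi n (psi m v) + psi m (psi n v) = 0"
    and psis_psis: "n \<in> half_ints \<Longrightarrow> m \<in> half_ints \<Longrightarrow> psis n (psis m v) + psis m (psis n v) = 0"
    and psi_vac: "n \<in> half_ints \<Longrightarrow> n > 0 \<Longrightarrow> psi n vac = 0"
    and psis_vac: "n \<in> half_ints \<Longrightarrow> n > 0 \<Longrightarrow> psis n vac = 0"
    and vac_nonzero: "vac \<noteq> 0"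
    and generated: "span (snd ` charge_monomials psi psis vac) = UNIV"
begin

definition charge_space :: "int \<Rightarrow> 'v set" where
  "charge_space m = span {v. (m, v) \<in> charge_monomials psi psis vac}"


subsection \<open>The conformal vector and its vertex operator\<close>

text \<open>
  A field \<open>a(x) = \<Sum>\<^sub>n a\<^sub>n x\<^bsup>-n-1\<^esup>\<close> is given by its modes \<open>a n\<close>.  In the vertex superalgebra \<open>\<F>\<close> one has
  \<open>Y(\<psi>(-1/2)1, x) = \<Sum> \<psi>(n) x\<^bsup>-n-1/2\<^esup>\<close>, similarly for \<open>\<psi>\<^sup>*\<close>, and the vertex operator of
  \<open>a(-3/2) b(-1/2) 1\<close> is the normally ordered product \<open>:a'(x) b(x):\<close>, where \<open>a'\<close> is the formal
  derivative.
\<close>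

definition psi_field :: "int \<Rightarrow> 'v \<Rightarrow> 'v" where
  "psi_field n = psi (of_int n + 1/2)"

definition psis_field :: "int \<Rightarrow> 'v \<Rightarrow> 'v" where
  "psis_field n = psis (of_int n + 1/2)"

definition deriv_field :: "(int \<Rightarrow> 'v \<Rightarrow> 'v) \<Rightarrow> int \<Rightarrow> 'v \<Rightarrow> 'v" where
  "deriv_field a n v = scale (- of_int n) (a (n - 1) v)"

text \<open>The minus sign is the sign rule for two odd fields.\<close>

definition normal_ordered :: "(int \<Rightarrow> 'v \<Rightarrow> 'v) \<Rightarrow> (int \<Rightarrow> 'v \<Rightarrow> 'v) \<Rightarrow> int \<Rightarrow> 'v \<Rightarrow> 'v" where
  "normal_ordered a b n v =
     Sum_any (\<lambda>j::int. if j < 0 then a j (b (n - j - 1) v) else - b (n - j - 1) (a j v))"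

definition omega :: 'v where
  "omega = scale (1/2) (psis (-3/2) (psi (-1/2) vac)) + scale (1/2) (psi (-3/2) (psis (-1/2) vac))"

definition omega_field :: "int \<Rightarrow> 'v \<Rightarrow> 'v" where
  "omega_field n v =
     scale (1/2) (normal_ordered (deriv_field psis_field) psi_field n v) +
     scale (1/2) (normal_ordered (deriv_field psi_field) psis_field n v)"

text \<open>\<open>Y(\<omega>, x) = \<Sum>\<^sub>n L(n) x\<^bsup>-n-2\<^esup>\<close>\<close>

definition L :: "int \<Rightarrow> 'v \<Rightarrow> 'v" where
  "L n = omega_field (n + 1)"

definition Lbar0 :: "'v \<Rightarrow> 'v" where
  "Lbar0 v = L 0 v - scale (1/24) v"


subsection \<open>The operators whose traces are taken\<close>

text \<open>\<open>X_psi (a, b)\<close> is the coefficient of \<open>t\<^sup>a x\<^sup>b\<close> in \<open>X(\<psi>, tx)\<close>, and \<open>X_psis b\<close> that of \<open>x\<^sup>b\<close> in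
  \<open>X(\<psi>\<^sup>*, x)\<close>.\<close>

definition X_psi :: "rat \<times> rat \<Rightarrow> 'v \<Rightarrow> 'v" where
  "X_psi = (\<lambda>(a, b) v. if a = b \<and> - a \<in> half_ints then psi (- a) v else 0)"

definition X_psis :: "rat \<Rightarrow> 'v \<Rightarrow> 'v" where
  "X_psis b v = (if - b \<in> half_ints then psis (- b) v else 0)"

definition XX :: "rat \<times> rat \<Rightarrow> 'v \<Rightarrow> 'v" where
  "XX = (\<lambda>(a, c) v. Sum_any (\<lambda>b. X_psi (a, b) (X_psis (c - b) v)))"

definition o_XX :: "rat \<Rightarrow> 'v \<Rightarrow> 'v" where
  "o_XX a = XX (a, 0)"


subsection \<open>Graded traces\<close>

text \<open>The trace of \<open>T\<close>, computed in a basis, on a finite-dimensional subspace \<open>W\<close> that \<open>T\<close> maps into itself.\<close>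

definition trace_on :: "'v set \<Rightarrow> ('v \<Rightarrow> 'v) \<Rightarrow> complex" where
  "trace_on W T =
     (let B = (SOME B. independent B \<and> span B = W) in \<Sum>b\<in>B. representation B (T b) b)"

text \<open>The coefficient of \<open>q\<^sup>r\<close> in the trace of \<open>T q\<^bsup>Lbar(0)\<^esup>\<close> on the charge \<open>m\<close> subspace.\<close>

definition graded_trace :: "int \<Rightarrow> ('v \<Rightarrow> 'v) \<Rightarrow> rat \<Rightarrow> complex" where
  "graded_trace m T r = trace_on {v \<in> charge_space m. Lbar0 v = scale (of_rat r) v} T"

definition G_coeff :: "rat list \<Rightarrow> rat \<Rightarrow> complex" where
  "G_coeff as k =
     Sum_any (\<lambda>r. eta_coeff r * graded_trace 0 (foldr (\<circ>) (map o_XX as) id) (k - r))"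

text \<open>
  The formal series \<open>G(m\<^sub>1, \<dots>, m\<^sub>n)\<close> with monomials as arguments: for example
  \<open>G [(1, 1, 0), (0, 0, 1)]\<close> is \<open>G(q t\<^sub>1, t\<^sub>2)\<close>, and \<open>G [(0, 1, 1)]\<close> is the one-variable \<open>G\<close> at
  \<open>t\<^sub>1 t\<^sub>2\<close>.
\<close>

definition G :: "monomial list \<Rightarrow> fseries" where
  "G = subst_fs G_coeff"

end


section \<open>Consistency checks\<close>

lemma half_ints_of_int [simp]: "of_int k + 1/2 \<in> half_ints"
  by (auto simp: half_ints_def)

context charged_fermion_fock
begin

lemma psi_field_0: "psi_field n 0 = 0" and psis_field_0: "psis_field n 0 = 0"
  using linear_psi[of "of_int n + 1/2"] linear_psis[of "of_int n + 1/2"]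
  by (simp_all add: psi_field_def psis_field_def linear_iff_module_hom module_hom.zero)

lemma field_vac: "n \<ge> 0 \<Longrightarrow> psi_field n vac = 0" "n \<ge> 0 \<Longrightarrow> psis_field n vac = 0"
  unfolding psi_field_def psis_field_def
  by (rule psi_vac psis_vac; simp add: add_nonneg_pos)+

lemma creation:
  assumes 0: "\<And>n. a n 0 = 0" "\<And>n. b n 0 = 0"
    and vac: "\<And>n. n \<ge> 0 \<Longrightarrow> a n vac = 0" "\<And>n. n \<ge> 0 \<Longrightarrow> b n vac = 0"
  shows "normal_ordered (deriv_field a) b (-1) vac = a (-2) (b (-1) vac)"
proof -
  have "(if j < 0 then deriv_field a j (b (-1 - j - 1) vac)
      else - b (-1 - j - 1) (deriv_field a j vac)) = (if j = -1 then a (-2) (b (-1) vac) else 0)" for j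
  proof -
    consider "j < -1" | "j = -1" | "j = 0" | "j > 0" by linarith
    then show ?thesis by cases (auto simp: deriv_field_def 0 vac)
  qed
  then show ?thesis by (simp add: normal_ordered_def)
qed

text \<open>The field \<^const>\<open>omega_field\<close> creates the conformal vector from the vacuum.\<close>

lemma omega_field_vac: "omega_field (-1) vac = omega"
proof -
  have "normal_ordered (deriv_field psis_field) psi_field (-1) vac = psis_field (-2) (psi_field (-1) vac)"
    "normal_ordered (deriv_field psi_field) psis_field (-1) vac = psi_field (-2) (psis_field (-1) vac)"
    by (intro creation field_vac psi_field_0 psis_field_0; assumption)+
  then show ?thesis
    by (simp add: omega_field_def omega_def psi_field_def psis_field_def)
qed

end


text \<open>
  A concrete Fock space: functions of finite support on the finite sets of occupied modes.  The mode
  \<open>k \<ge> 0\<close> is created by \<open>\<psi>(-k-1/2)\<close>, the mode \<open>k < 0\<close> by \<open>\<psi>\<^sup>*(k+1/2)\<close>.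
\<close>

type_synonym fock = "int fset \<Rightarrow>\<^sub>0 complex"

definition mode_sign :: "int \<Rightarrow> int fset \<Rightarrow> complex" where
  "mode_sign k S = (-1) ^ card {j \<in> fset S. j < k}"

lift_definition fock_scale :: "complex \<Rightarrow> fock \<Rightarrow> fock" is "\<lambda>c p S. c * p S"
  by (rule finite_subset[rotated], assumption) auto

lift_definition create :: "int \<Rightarrow> fock \<Rightarrow> fock" is
  "\<lambda>k p S. if k |\<in>| S then mode_sign k S * p (S |-| {|k|}) else 0"
proof -
  fix k and p :: "int fset \<Rightarrow> complex"
  assume "finite {S. p S \<noteq> 0}"
  moreover have "{S. (if k |\<in>| S then mode_sign k S * p (S |-| {|k|}) else 0) \<noteq> 0}
      \<subseteq> finsert k ` {S. p S \<noteq> 0}"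
    by (auto intro!: image_eqI[where x = "_ |-| {|k|}"] split: if_splits)
  ultimately show "finite {S. (if k |\<in>| S then mode_sign k S * p (S |-| {|k|}) else 0) \<noteq> 0}"
    by (meson finite_imageI finite_subset)
qed

lift_definition annihilate :: "int \<Rightarrow> fock \<Rightarrow> fock" is
  "\<lambda>k p S. if k |\<in>| S then 0 else mode_sign k S * p (finsert k S)"
proof -
  fix k and p :: "int fset \<Rightarrow> complex"
  assume "finite {S. p S \<noteq> 0}"
  moreover have "{S. (if k |\<in>| S then 0 else mode_sign k S * p (finsert k S)) \<noteq> 0}
      \<subseteq> (\<lambda>S. S |-| {|k|}) ` {S. p S \<noteq> 0}"
    by (auto intro!: image_eqI[where x = "finsert k _"] split: if_splits)
  ultimately show "finite {S. (if k |\<in>| S then 0 else mode_sign k S * p (finsert k S)) \<noteq> 0}"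
    by (meson finite_imageI finite_subset)
qed

definition fock_psi :: "rat \<Rightarrow> fock \<Rightarrow> fock" where
  "fock_psi n = (if n < 0 then create \<lfloor>- n\<rfloor> else annihilate \<lfloor>- n\<rfloor>)"

definition fock_psis :: "rat \<Rightarrow> fock \<Rightarrow> fock" where
  "fock_psis n = (if n < 0 then create \<lfloor>n\<rfloor> else annihilate \<lfloor>n\<rfloor>)"

lemma mode_sign_finsert:
  "k |\<notin>| S \<Longrightarrow> mode_sign j (finsert k S) = (if k < j then - mode_sign j S else mode_sign j S)"
proof -
  assume k: "k |\<notin>| S"
  have "{i \<in> fset (finsert k S). i < j} =
      (if k < j then insert k {i \<in> fset S. i < j} else {i \<in> fset S. i < j})"
    by auto
  with k show ?thesis by (simp add: mode_sign_def)
qed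

lemma mode_sign_fminus:
  assumes "k |\<in>| S"
  shows "mode_sign j (S |-| {|k|}) = (if k < j then - mode_sign j S else mode_sign j S)"
proof -
  have "S = finsert k (S |-| {|k|})" using assms by auto
  then have "mode_sign j S = (if k < j then - mode_sign j (S |-| {|k|}) else mode_sign j (S |-| {|k|}))"
    using mode_sign_finsert[of k "S |-| {|k|}" j] by auto
  then show ?thesis by auto
qed

lemma mode_sign_sq [simp]: "mode_sign k S * mode_sign k S = 1"
  by (simp add: mode_sign_def flip: power_add mult_2)

lemma mode_sign_self [simp]: "mode_sign k (S |-| {|k|}) = mode_sign k S"
  "mode_sign k (finsert k S) = mode_sign k S"
  by (cases "k |\<in>| S"; simp add: mode_sign_fminus mode_sign_finsert finsert_absorb)+

lemma mode_sign_swap: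
  "j \<noteq> k \<Longrightarrow> j |\<in>| S \<Longrightarrow> k |\<in>| S \<Longrightarrow>
    mode_sign j S * mode_sign k (S |-| {|j|}) = - (mode_sign k S * mode_sign j (S |-| {|k|}))"
  "j \<noteq> k \<Longrightarrow> j |\<notin>| S \<Longrightarrow> k |\<notin>| S \<Longrightarrow>
    mode_sign j S * mode_sign k (finsert j S) = - (mode_sign k S * mode_sign j (finsert k S))"
  "j \<noteq> k \<Longrightarrow> j |\<in>| S \<Longrightarrow> k |\<notin>| S \<Longrightarrow>
    mode_sign j S * mode_sign k (S |-| {|j|}) = - (mode_sign k S * mode_sign j (finsert k S))"
  by (cases j k rule: linorder_cases; simp add: mode_sign_fminus mode_sign_finsert)+

lemma create_create: "create j (create k p) + create k (create j p) = 0"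
proof (rule poly_mapping_eqI)
  fix S
  have "S |-| {|j|} |-| {|k|} = S |-| {|k|} |-| {|j|}" by auto
  then show "Poly_Mapping.lookup (create j (create k p) + create k (create j p)) S = Poly_Mapping.lookup 0 S"
    using mode_sign_swap(1)[of j k S]
    by (cases "j = k") (auto simp: lookup_add create.rep_eq simp flip: mult.assoc distrib_right)
qed

lemma annihilate_annihilate: "annihilate j (annihilate k p) + annihilate k (annihilate j p) = 0"
proof (rule poly_mapping_eqI)
  fix S
  have "finsert j (finsert k S) = finsert k (finsert j S)" by auto
  then show "Poly_Mapping.lookup (annihilate j (annihilate k p) + annihilate k (annihilate j p)) S = Poly_Mapping.lookup 0 S"
    using mode_sign_swap(2)[of j k S]
    by (cases "j = k") (auto simp: lookup_add annihilate.rep_eq simp flip: mult.assoc distrib_right)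
qed

lemma create_annihilate:
  "create j (annihilate k p) + annihilate k (create j p) = (if j = k then p else 0)"
proof (rule poly_mapping_eqI)
  fix S
  have "finsert k (S |-| {|j|}) = finsert k S |-| {|j|}" if "j \<noteq> k" using that by auto
  moreover have "finsert j (S |-| {|j|}) = S" if "j |\<in>| S" using that by auto
  ultimately show "Poly_Mapping.lookup (create j (annihilate k p) + annihilate k (create j p)) S =
      Poly_Mapping.lookup (if j = k then p else 0) S"
    using mode_sign_swap(3)[of j k S]
    by (cases "j = k")
      (auto simp: lookup_add create.rep_eq annihilate.rep_eq mode_sign_fminus mode_sign_finsert
        simp flip: mult.assoc distrib_right)
qed

lemma fock_vector_space: "vector_space fock_scale"
  by unfold_locales
    (rule poly_mapping_eqI, simp add: fock_scale.rep_eq lookup_add algebra_simps)+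

lemma linear_create: "Vector_Spaces.linear fock_scale fock_scale (create k)"
  using fock_vector_space
  by (auto simp: Vector_Spaces.linear_iff lookup_add create.rep_eq fock_scale.rep_eq algebra_simps
      intro!: poly_mapping_eqI)

lemma linear_annihilate: "Vector_Spaces.linear fock_scale fock_scale (annihilate k)"
  using fock_vector_space
  by (auto simp: Vector_Spaces.linear_iff lookup_add annihilate.rep_eq fock_scale.rep_eq algebra_simps
      intro!: poly_mapping_eqI)

lemma create_single:
  assumes "k |\<notin>| S"
  shows "create k (Poly_Mapping.single S c) =
           Poly_Mapping.single (finsert k S) (mode_sign k S * c)"
  using assms
  by (intro poly_mapping_eqI) (auto simp: create.rep_eq lookup_single when_def mode_sign_finsert)

lemma charged_fermion_fock_exists:
  "charged_fermion_fock fock_scale fock_psi fock_psis (Poly_Mapping.single {||} 1)"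
proof -
  interpret vector_space fock_scale by (rule fock_vector_space)
  let ?vac = "Poly_Mapping.single {||} 1 :: fock"
  let ?M = "snd ` charge_monomials fock_psi fock_psis ?vac"
  have create_cases: "create k = (if k \<ge> 0 then fock_psi (of_int (- k - 1) + 1/2)
      else fock_psis (of_int k + 1/2))" for k
  proof -
    have "\<lfloor>- (of_int (- k - 1) + 1/2 :: rat)\<rfloor> = k" "\<lfloor>of_int k + 1/2 :: rat\<rfloor> = k"
      by linarith+
    then show ?thesis
      by (auto simp: fock_psi_def fock_psis_def)
  qed
  have create_M: "create k v \<in> ?M" if v: "v \<in> ?M" for k v
  proof -
    obtain m where "(m, v) \<in> charge_monomials fock_psi fock_psis ?vac" using v by auto
    then have "\<exists>m. (m, create k v) \<in> charge_monomials fock_psi fock_psis ?vac"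
      by (cases "k \<ge> 0")
        (simp_all only: create_cases if_True if_False,
          (rule exI, erule charge_monomials.intros(2,3), rule half_ints_of_int)+)
    then show ?thesis by force
  qed
  have single: "Poly_Mapping.single S 1 \<in> span ?M" for S
  proof -
    have "\<exists>c v. v \<in> ?M \<and> Poly_Mapping.single S 1 = fock_scale c v"
    proof (induction S)
      case empty
      have "?vac \<in> ?M" using charge_monomials.intros(1) by (rule image_eqI[rotated]) simp
      then show ?case by (intro exI[of _ 1] exI[of _ ?vac]) simp
    next
      case (insert k S)
      then obtain c v where v: "v \<in> ?M" "Poly_Mapping.single S 1 = fock_scale c v" by blast
      have "Poly_Mapping.single (finsert k S) 1 =
          fock_scale (mode_sign k S) (create k (Poly_Mapping.single S 1))"
        using insert.hyps mode_sign_sq[of k S]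
        by (intro poly_mapping_eqI)
          (auto simp: create_single fock_scale.rep_eq lookup_single when_def)
      also have "\<dots> = fock_scale (mode_sign k S * c) (create k v)"
        using linear_create[of k] by (simp add: v Vector_Spaces.linear_iff)
      finally show ?case using create_M[OF v(1), of k] by blast
    qed
    then show ?thesis by (metis span_base span_scale)
  qed
  have "p \<in> span ?M" for p
  proof (induction p rule: update_induct)
    case const
    show ?case by (rule span_zero)
  next
    case (update p S c)
    have "Poly_Mapping.update S c p = p + fock_scale c (Poly_Mapping.single S 1)"
      using update.hyps
      by (intro poly_mapping_eqI)
        (auto simp: fock_scale.rep_eq lookup_add lookup_single when_def lookup_update in_keys_iff)
    then show ?case by (simp add: update.IH single span_add span_scale)
  qed
  then have gen: "span ?M = UNIV" by blast
  have floor_psi: "\<lfloor>- n\<rfloor> = \<lfloor>m\<rfloor> \<longleftrightarrow> m + n = 0" "\<lfloor>- n\<rfloor> = \<lfloor>- m\<rfloor> \<longleftrightarrow> n = m"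
      "\<lfloor>n\<rfloor> = \<lfloor>m\<rfloor> \<longleftrightarrow> n = m"
    if nm: "n \<in> half_ints" "m \<in> half_ints" for n m
  proof -
    obtain i j :: int where ij: "n = of_int i + 1/2" "m = of_int j + 1/2"
      using nm by (auto simp: half_ints_def)
    have fl: "\<lfloor>of_int k + 1/2 :: rat\<rfloor> = k" "\<lfloor>- (of_int k + 1/2 :: rat)\<rfloor> = - k - 1" for k
      by linarith+
    have "m + n = of_int (i + j + 1)" by (simp add: ij)
    then have "m + n = 0 \<longleftrightarrow> i + j + 1 = 0" by (simp only: of_int_eq_0_iff)
    then show "\<lfloor>- n\<rfloor> = \<lfloor>m\<rfloor> \<longleftrightarrow> m + n = 0" unfolding ij fl by linarith
    show "\<lfloor>- n\<rfloor> = \<lfloor>- m\<rfloor> \<longleftrightarrow> n = m" "\<lfloor>n\<rfloor> = \<lfloor>m\<rfloor> \<longleftrightarrow> n = m" unfolding ij fl by simp_all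
  qed
  have nonzero: "n \<noteq> 0" if n: "n \<in> half_ints" for n
  proof
    assume "n = 0"
    then obtain k :: int where "of_int k + 1/2 = (0::rat)" using n by (auto simp: half_ints_def)
    then have "of_int (2 * k + 1) = (0::rat)" by simp
    then have "2 * k + 1 = 0" by (simp only: of_int_eq_0_iff)
    then show False by presburger
  qed
  note anni = create_create annihilate_annihilate create_annihilate
    create_annihilate[unfolded add.commute[of "create _ _"]]
  show ?thesis
  proof (intro charged_fermion_fock.intro charged_fermion_fock_axioms.intro fock_vector_space)
    show "Vector_Spaces.linear fock_scale fock_scale (fock_psi n)"
      "Vector_Spaces.linear fock_scale fock_scale (fock_psis n)" for n
      by (simp_all add: fock_psi_def fock_psis_def linear_create linear_annihilate)
    show "span ?M = UNIV" by (rule gen)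
    show "?vac \<noteq> 0" by (metis lookup_single_eq lookup_zero zero_neq_one)
    show "fock_psi n ?vac = 0" "fock_psis n ?vac = 0" if "n > 0" for n
      using that by (auto intro!: poly_mapping_eqI
          simp: fock_psi_def fock_psis_def annihilate.rep_eq lookup_single when_def)
    fix n m v assume nm: "n \<in> half_ints" "m \<in> half_ints"
    note [simp] = floor_psi[OF nm] floor_psi[OF nm, unfolded eq_commute[of "\<lfloor>- n\<rfloor>"] eq_commute[of "\<lfloor>n\<rfloor>"]]
    have *: "n \<noteq> 0" "m \<noteq> 0" using nonzero nm by blast+
    show "fock_psi n (fock_psis m v) + fock_psis m (fock_psi n v) = (if m + n = 0 then v else 0)"
      using * by (auto simp: fock_psi_def fock_psis_def anni)
    show "fock_psi n (fock_psi m v) + fock_psi m (fock_psi n v) = 0"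
      using * by (auto simp: fock_psi_def anni)
    show "fock_psis n (fock_psis m v) + fock_psis m (fock_psis n v) = 0"
      using * by (auto simp: fock_psis_def anni)
  qed
qed

end

theory Submission
  imports Defs
begin

text \<open>
  The modes \<open>occupy k = \<psi>(-k-1/2)\<close> and \<open>vacate k = \<psi>\<^sup>*(k+1/2)\<close>, for \<open>k\<close> an integer, fill and empty a
  level \<open>k\<close>, and the vacuum is the state in which exactly the negative levels are filled.  Hence the
  Fock space has a basis of vectors \<^term>\<open>state M\<close>, where \<open>M\<close> (a Maya diagram) is the set of filled
  levels and differs from the negative integers in a finite set.  Everything in the trace is diagonal
  in this basis: \<open>L(0)\<close> has the energy of \<open>M\<close> as its eigenvalue (\<open>L0_state\<close>), and the coefficient of
  \<open>t\<^sup>a\<close> in \<open>o(X(\<psi>,tx)X(\<psi>\<^sup>*,x))\<close>, which is \<open>\<psi>(-a)\<psi>\<^sup>*(a)\<close>, is the projection to the diagrams in which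
  level \<open>a-1/2\<close> is filled; call \<open>a\<close> filled in this case.  So the coefficient of \<open>t\<^sub>1\<^sup>a t\<^sub>2\<^sup>b\<close> in
  \<open>G\<close> counts, up to the factor from \<open>\<eta>(q)\<close>, the diagrams of charge \<open>0\<close> with \<open>a\<close> and \<open>b\<close> filled (\<open>graded_trace_card\<close>).

  Write \<open>g(b)\<close> and \<open>g(a,b)\<close> for these coefficients.  Then \<open>g(b) - g(a,b)\<close> counts diagrams in which \<open>b\<close> is
  filled and \<open>a\<close> is empty.  Filling \<open>a\<close> raises the charge to \<open>1\<close>, and then moving all particles
  one level down brings it back to \<open>0\<close>.  For \<open>a \<noteq> b\<close> this is a bijection with the diagrams in which
  \<open>a-1\<close> and \<open>b-1\<close> are filled, and it raises the energy by \<open>a-1/2\<close>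
  (\<open>card_fill_and_lower\<close>).  Therefore \<open>q\<^sup>a (g(b) - g(a,b)) = q\<^bsup>1/2\<^esup> g(a-1,b-1)\<close>, which is the first identity
  off the diagonal.  On the diagonal, \<open>g(a,a) = g(a)\<close> because the projections are idempotent, and
  the term \<open>G(t\<^sub>1t\<^sub>2)\<close> accounts for exactly this.

  The second identity follows from the first: the bracket is \<open>\<delta>\<^bsub>1/2\<^esub>(qt\<^sub>1) G(t\<^sub>2)\<close>, and the factor
  \<open>1 - qt\<^sub>1\<close> kills \<open>\<delta>\<^bsub>1/2\<^esub>(qt\<^sub>1)\<close>.
\<close>

(* Inside the locale of vector spaces, the symbol *s is to mean the abstract scalar multiplication only. *)
no_notation vector_scalar_mult (infixl "*s" 70)

section \<open>Traces and eigenspaces of diagonal operators\<close>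

context vector_space
begin

lemma linear_opI:
  assumes "\<And>v w. T (v + w) = T v + T w" "\<And>c v. T (c *s v) = c *s T v"
  shows "Vector_Spaces.linear scale scale T"
  using assms by (simp add: Vector_Spaces.linear_iff vector_space_axioms)

lemma linear_opD:
  assumes "Vector_Spaces.linear scale scale T"
  shows "T (v + w) = T v + T w" "T (c *s v) = c *s T v" "T 0 = 0" "T (v - w) = T v - T w"
    "T (\<Sum>i\<in>A. g i) = (\<Sum>i\<in>A. T (g i))"
proof -
  interpret module_hom scale scale T using assms by (simp add: linear_iff_module_hom)
  show "T (v + w) = T v + T w" "T (c *s v) = c *s T v" "T 0 = 0" "T (v - w) = T v - T w"
    "T (\<Sum>i\<in>A. g i) = (\<Sum>i\<in>A. T (g i))"
    by (simp_all add: add scale zero diff sum)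
qed

text \<open>
  The trace does not depend on the basis: expand each vector of \<open>B\<close> in \<open>C\<close>, exchange the two sums, and
  collect the expansion of \<open>T c\<close> in \<open>B\<close>.
\<close>

lemma diagonal_sum_basis_independent:
  assumes B: "independent B" "finite B" and C: "independent C" "finite C" "span C = span B"
    and T: "Vector_Spaces.linear scale scale T" "\<And>v. v \<in> span B \<Longrightarrow> T v \<in> span B"
  shows "(\<Sum>b\<in>B. representation B (T b) b) = (\<Sum>c\<in>C. representation C (T c) c)"
proof -
  have expand: "(\<Sum>c\<in>C. representation C v c *s c) = v" if "v \<in> span B" for v
    using that C by (intro sum_representation_eq) auto
  have expand': "(\<Sum>b\<in>B. representation B v b *s b) = v" if "v \<in> span B" for v
    using that B by (intro sum_representation_eq) auto
  have TC: "T c \<in> span B" if "c \<in> C" for c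
    using that T(2) C(3) span_base by metis
  have "representation B (T b) b = (\<Sum>c\<in>C. representation C b c * representation B (T c) b)"
    if b: "b \<in> B" for b
  proof -
    have "T b = T (\<Sum>c\<in>C. representation C b c *s c)"
      using b by (simp add: expand span_base)
    also have "\<dots> = (\<Sum>c\<in>C. representation C b c *s T c)"
      by (simp add: linear_opD[OF T(1)])
    finally have "representation B (T b) b = representation B (\<Sum>c\<in>C. representation C b c *s T c) b"
      by simp
    also have "\<dots> = (\<Sum>c\<in>C. representation B (representation C b c *s T c) b)"
      using B TC by (simp add: representation_sum span_scale)
    finally show ?thesis using B TC by (simp add: representation_scale)
  qed
  then have "(\<Sum>b\<in>B. representation B (T b) b)
      = (\<Sum>b\<in>B. \<Sum>c\<in>C. representation C b c * representation B (T c) b)"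
    by (intro sum.cong) auto
  also have "\<dots> = (\<Sum>c\<in>C. \<Sum>b\<in>B. representation C b c * representation B (T c) b)"
    by (rule sum.swap)
  also have "\<dots> = (\<Sum>c\<in>C. representation C (T c) c)"
  proof (intro sum.cong refl)
    fix c assume c: "c \<in> C"
    have "representation C (T c) c = representation C (\<Sum>b\<in>B. representation B (T c) b *s b) c"
      by (simp add: expand' TC c)
    also have "\<dots> = (\<Sum>b\<in>B. representation C (representation B (T c) b *s b) c)"
      using C by (simp add: representation_sum span_base span_scale)
    also have "\<dots> = (\<Sum>b\<in>B. representation B (T c) b * representation C b c)"
      using C by (intro sum.cong) (auto simp: representation_scale span_base)
    finally show "(\<Sum>b\<in>B. representation C b c * representation B (T c) b) = representation C (T c) c"
      by (simp add: mult.commute)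
  qed
  finally show ?thesis .
qed

text \<open>
  Indexing by \<open>I\<close> rather than speaking of the set \<open>e ` I\<close> makes injectivity of \<open>e\<close> part of the notion.
\<close>

definition independent_family :: "('i \<Rightarrow> 'b) \<Rightarrow> 'i set \<Rightarrow> bool" where
  "independent_family e I \<longleftrightarrow>
     (\<forall>A c. finite A \<longrightarrow> A \<subseteq> I \<longrightarrow> (\<Sum>i\<in>A. c i *s e i) = 0 \<longrightarrow> (\<forall>i\<in>A. c i = 0))"

end

context vector_space
begin

lemma independent_familyD:
  assumes "independent_family e I" "finite A" "A \<subseteq> I" "(\<Sum>i\<in>A. c i *s e i) = 0" "i \<in> A"
  shows "c i = 0"
  using assms unfolding independent_family_def by simp

lemma independent_family_subset:
  "independent_family e I \<Longrightarrow> J \<subseteq> I \<Longrightarrow> independent_family e J"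
  unfolding independent_family_def by (meson order_trans)

lemma independent_family_inj:
  assumes "independent_family e I"
  shows "inj_on e I"
proof (rule inj_onI, rule ccontr)
  fix i j assume ij: "i \<in> I" "j \<in> I" "e i = e j" "i \<noteq> j"
  let ?c = "\<lambda>l. if l = i then 1 else - 1"
  have "(\<Sum>l\<in>{i, j}. ?c l *s e l) = 0" using ij by simp
  from independent_familyD[OF assms _ _ this, of i] ij(1,2) show False by simp
qed

lemma independent_family_independent:
  assumes "independent_family e I"
  shows "independent (e ` I)"
  unfolding independent_explicit_finite_subsets
proof (intro allI impI)
  fix S u assume S: "S \<subseteq> e ` I" "finite S" and 0: "(\<Sum>v\<in>S. u v *s v) = 0"
  obtain A where A: "A \<subseteq> I" "finite A" "S = e ` A"
    using finite_subset_image[OF S(2,1)] by metis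
  have "inj_on e A" using independent_family_inj[OF assms] A(1) inj_on_subset by blast
  then have "(\<Sum>i\<in>A. u (e i) *s e i) = 0"
    using 0 by (simp add: A(3) sum.reindex)
  from independent_familyD[OF assms A(2,1) this] show "\<forall>v\<in>S. u v = 0" by (simp add: A(3))
qed

text \<open>
  If two indices occur in a linear relation, some operator \<open>N k\<close> tells them apart; it splits the relation
  into two relations with fewer terms, according to the truth value of \<open>P k\<close>.  A relation with
  one term is trivial.
\<close>

lemma separated_family_independent:
  assumes nonzero: "\<And>i. i \<in> I \<Longrightarrow> e i \<noteq> 0"
    and lin: "\<And>k. Vector_Spaces.linear scale scale (N k)"
    and N: "\<And>i k. i \<in> I \<Longrightarrow> N k (e i) = (if P k i then e i else 0)"
    and sep: "\<And>i j. i \<in> I \<Longrightarrow> j \<in> I \<Longrightarrow> i \<noteq> j \<Longrightarrow> \<exists>k. P k i \<noteq> P k j"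
  shows "independent_family e I"
  unfolding independent_family_def
proof (intro allI impI)
  fix A c assume "finite A" "A \<subseteq> I" "(\<Sum>i\<in>A. c i *s e i) = 0"
  then show "\<forall>i\<in>A. c i = 0"
  proof (induction A rule: finite_psubset_induct)
    case (psubset A)
    show ?case
    proof (cases "\<exists>i\<in>A. \<exists>j\<in>A. i \<noteq> j")
      case True
      then obtain i j where ij: "i \<in> A" "j \<in> A" "i \<noteq> j" by blast
      then obtain k where k: "P k i \<noteq> P k j"
        using sep[of i j] psubset.prems(1) by blast
      let ?on = "{l \<in> A. P k l}" and ?off = "{l \<in> A. \<not> P k l}"
      have "0 = N k (\<Sum>l\<in>A. c l *s e l)"
        by (simp add: psubset.prems(2) linear_opD[OF lin])
      also have "\<dots> = (\<Sum>l\<in>A. if P k l then c l *s e l else 0)"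
        using psubset.prems(1) by (auto simp: linear_opD[OF lin] N intro!: sum.cong)
      finally have on: "(\<Sum>l\<in>?on. c l *s e l) = 0"
        using psubset.hyps by (simp add: sum.inter_filter)
      have "(\<Sum>l\<in>A. c l *s e l) = (\<Sum>l\<in>?on. c l *s e l) + (\<Sum>l\<in>?off. c l *s e l)"
        using psubset.hyps by (subst sum.union_disjoint[symmetric]) (auto intro!: sum.cong)
      with on have off: "(\<Sum>l\<in>?off. c l *s e l) = 0" using psubset.prems(2) by simp
      have "\<forall>l\<in>?on. c l = 0" "\<forall>l\<in>?off. c l = 0"
        using ij k psubset.prems(1) by (intro psubset.IH on off; blast)+
      then show ?thesis by blast
    next
      case False
      show ?thesis
      proof
        fix i assume i: "i \<in> A"
        with False have "A = {i}" by auto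
        then show "c i = 0" using psubset.prems nonzero[of i] by auto
      qed
    qed
  qed
qed

lemma span_family:
  assumes "inj_on e I" "v \<in> span (e ` I)"
  obtains A c where "finite A" "A \<subseteq> I" "v = (\<Sum>i\<in>A. c i *s e i)"
proof -
  obtain S u where S: "finite S" "S \<subseteq> e ` I" "v = (\<Sum>b\<in>S. u b *s b)"
    using assms(2) unfolding span_explicit by auto
  obtain A where A: "A \<subseteq> I" "finite A" "S = e ` A"
    using finite_subset_image[OF S(1,2)] by metis
  have "inj_on e A" using assms(1) A(1) inj_on_subset by blast
  then have "v = (\<Sum>i\<in>A. u (e i) *s e i)" by (simp add: S(3) A(3) sum.reindex)
  then show ?thesis by (rule that[OF A(2,1)])
qed

text \<open>
  Comparing coefficients in \<open>D v = s *s v\<close> leaves only the basis vectors with eigenvalue \<open>s\<close>.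
\<close>

lemma diagonal_eigenspace:
  assumes ind: "independent_family e I" and D: "Vector_Spaces.linear scale scale D"
    and eig: "\<And>i. i \<in> I \<Longrightarrow> D (e i) = w i *s e i"
  shows "{v \<in> span (e ` I). D v = s *s v} = span (e ` {i \<in> I. w i = s})"
proof (intro subset_antisym subsetI)
  fix v assume "v \<in> {v \<in> span (e ` I). D v = s *s v}"
  then have v: "v \<in> span (e ` I)" "D v = s *s v" by auto
  obtain A c where A: "finite A" "A \<subseteq> I" "v = (\<Sum>i\<in>A. c i *s e i)"
    using span_family[OF independent_family_inj[OF ind] v(1)] .
  have "D v - s *s v = (\<Sum>i\<in>A. c i *s D (e i)) - (\<Sum>i\<in>A. s *s c i *s e i)"
    by (simp add: A(3) linear_opD[OF D] scale_sum_right)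
  also have "\<dots> = (\<Sum>i\<in>A. (c i * (w i - s)) *s e i)"
    unfolding sum_subtractf[symmetric]
    using A(2) by (intro sum.cong) (auto simp: eig scale_left_diff_distrib right_diff_distrib mult.commute)
  finally have "(\<Sum>i\<in>A. (c i * (w i - s)) *s e i) = 0" using v(2) by simp
  from independent_familyD[OF ind A(1,2) this]
  have zero: "c i = 0 \<or> w i = s" if "i \<in> A" for i using that by auto
  have "c i *s e i \<in> span (e ` {i \<in> I. w i = s})" if "i \<in> A" for i
  proof (cases "c i = 0")
    case False
    then have "e i \<in> e ` {i \<in> I. w i = s}" using zero that A(2) by auto
    then show ?thesis by (intro span_scale span_base)
  qed (simp add: span_zero)
  then show "v \<in> span (e ` {i \<in> I. w i = s})" by (simp add: A(3) span_sum)
next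
  fix v assume v: "v \<in> span (e ` {i \<in> I. w i = s})"
  have "v \<in> span (e ` I)" using v span_mono[of "e ` {i \<in> I. w i = s}" "e ` I"] by blast
  moreover have "D v = s *s v"
    using v by (induction rule: span_induct_alt) (auto simp: linear_opD[OF D] eig scale_right_distrib mult.commute)
  ultimately show "v \<in> {v \<in> span (e ` I). D v = s *s v}" by blast
qed

lemma linear_op_Sum_any:
  assumes T: "\<And>j. Vector_Spaces.linear scale scale (T j)" and fin: "\<And>v. finite {j. T j v \<noteq> 0}"
  shows "Vector_Spaces.linear scale scale (\<lambda>v. Sum_any (\<lambda>j. T j v))"
proof (rule linear_opI)
  show "Sum_any (\<lambda>j. T j (v + w)) = Sum_any (\<lambda>j. T j v) + Sum_any (\<lambda>j. T j w)" for v w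
    by (simp add: linear_opD[OF T] Sum_any.distrib fin)
  show "Sum_any (\<lambda>j. T j (c *s v)) = c *s Sum_any (\<lambda>j. T j v)" for c v
  proof -
    let ?J = "{j. T j v \<noteq> 0}"
    have "Sum_any (\<lambda>j. T j (c *s v)) = (\<Sum>j\<in>?J. c *s T j v)"
      using fin by (subst Sum_any.expand_superset[of ?J]) (auto simp: linear_opD[OF T])
    also have "\<dots> = c *s Sum_any (\<lambda>j. T j v)"
      by (simp add: Sum_any.expand_set scale_sum_right)
    finally show ?thesis .
  qed
qed

end

section \<open>Products of creation modes\<close>

context charged_fermion_fock
begin

text \<open>
  Level \<open>k\<close> stands for the half-integer \<open>k + 1/2\<close>.  Since \<^const>\<open>psi_field\<close> \<open>n\<close> is \<open>\<psi>(n + 1/2)\<close>, the first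
  mode is \<open>\<psi>(-k-1/2)\<close>, the partner of \<open>\<psi>\<^sup>*(k+1/2)\<close> in the anticommutation relations.
\<close>

definition occupy :: "int \<Rightarrow> 'v \<Rightarrow> 'v" where
  "occupy k = psi_field (- k - 1)"

definition vacate :: "int \<Rightarrow> 'v \<Rightarrow> 'v" where
  "vacate k = psis_field k"

text \<open>
  The modes that do not kill the vacuum: filling a non-negative level or emptying a negative one.
  Each \<^term>\<open>relax k\<close> kills the vacuum and is conjugate to \<^term>\<open>excite k\<close>.
\<close>

definition excite :: "int \<Rightarrow> 'v \<Rightarrow> 'v" where
  "excite k = (if k \<ge> 0 then occupy k else vacate k)"

definition relax :: "int \<Rightarrow> 'v \<Rightarrow> 'v" where
  "relax k = (if k \<ge> 0 then vacate k else occupy k)"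

lemma linear_occupy: "Vector_Spaces.linear scale scale (occupy k)"
  unfolding occupy_def psi_field_def by (rule linear_psi) (rule half_ints_of_int)

lemma linear_vacate: "Vector_Spaces.linear scale scale (vacate k)"
  unfolding vacate_def psis_field_def by (rule linear_psis) (rule half_ints_of_int)

lemma linear_excite: "Vector_Spaces.linear scale scale (excite k)"
  by (simp add: excite_def linear_occupy linear_vacate)

lemma linear_relax: "Vector_Spaces.linear scale scale (relax k)"
  by (simp add: relax_def linear_occupy linear_vacate)

lemma occupy_vacate: "occupy k (vacate l v) + vacate l (occupy k v) = (if k = l then v else 0)"
proof -
  have eq: "of_int l + 1/2 + (of_int (- k - 1) + 1/2) = (of_int (l - k) :: rat)" by simp
  show ?thesis
    unfolding occupy_def vacate_def psi_field_def psis_field_def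
    by (subst psi_psis; (rule half_ints_of_int)?; unfold eq of_int_eq_0_iff; auto)
qed

lemma occupy_occupy: "occupy k (occupy l v) + occupy l (occupy k v) = 0"
  unfolding occupy_def psi_field_def by (rule psi_psi; rule half_ints_of_int)

lemma vacate_vacate: "vacate k (vacate l v) + vacate l (vacate k v) = 0"
  unfolding vacate_def psis_field_def by (rule psis_psis; rule half_ints_of_int)

lemma excite_excite: "excite k (excite l v) + excite l (excite k v) = 0"
proof -
  have "vacate l (occupy k v) + occupy k (vacate l v) = (if k = l then v else 0)" for k l
    using occupy_vacate[of k l v] by (simp add: add.commute)
  then show ?thesis
    by (auto simp: excite_def occupy_vacate occupy_occupy vacate_vacate)
qed

lemma relax_excite: "relax k (excite l v) + excite l (relax k v) = (if k = l then v else 0)"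
proof -
  have "vacate l (occupy k v) + occupy k (vacate l v) = (if k = l then v else 0)" for k l
    using occupy_vacate[of k l v] by (simp add: add.commute)
  then show ?thesis
    by (auto simp: relax_def excite_def occupy_vacate occupy_occupy vacate_vacate)
qed

lemma relax_vac: "relax k vac = 0"
  by (simp add: relax_def occupy_def vacate_def field_vac)

lemma excite_swap: "excite k (excite l v) = - excite l (excite k v)"
  using excite_excite[of k l v] by (simp add: eq_neg_iff_add_eq_0)

lemma excite_twice: "excite k (excite k v) = 0"
proof -
  have "scale 2 (excite k (excite k v)) = 0"
    using excite_excite[of k k v] scale_left_distrib[of 1 1 "excite k (excite k v)"] by simp
  then show ?thesis by simp
qed

definition excited :: "int set \<Rightarrow> 'v" where
  "excited S = foldr excite (sorted_list_of_set S) vac"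

lemma excited_empty: "excited {} = vac"
  by (simp add: excited_def)

lemma excited_Min:
  assumes "finite S" "S \<noteq> {}"
  shows "excited S = excite (Min S) (excited (S - {Min S}))"
  using assms by (simp add: excited_def sorted_list_of_set_nonempty)

text \<open>
  Induction that adds elements in decreasing order, as the ordered product \<^term>\<open>excited S\<close> is built.
\<close>

lemma excited_induct [consumes 1, case_names empty insert]:
  assumes "finite (S :: int set)" "P {}"
    and "\<And>k S. finite S \<Longrightarrow> (\<And>j. j \<in> S \<Longrightarrow> k < j) \<Longrightarrow> P S \<Longrightarrow> P (insert k S)"
  shows "P S"
  using assms(1)
proof (induction "card S" arbitrary: S)
  case 0
  then show ?case using assms(2) by simp
next
  case (Suc n)
  then have S: "S \<noteq> {}" by auto
  have "P (insert (Min S) (S - {Min S}))"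
  proof (rule assms(3))
    show "P (S - {Min S})" using Suc S by (intro Suc.hyps(1)) auto
    show "Min S < j" if "j \<in> S - {Min S}" for j
      using that Suc.prems Min_le[of S j] by (auto simp: order_less_le)
  qed (use Suc.prems in simp)
  then show ?case using S Suc.prems by (simp add: insert_absorb)
qed

lemma excited_insert_least:
  assumes "finite S" "\<And>j. j \<in> S \<Longrightarrow> k < j"
  shows "excited (insert k S) = excite k (excited S)"
proof -
  have "Min (insert k S) = k" using assms by (intro Min_eqI) (auto intro: less_imp_le)
  moreover have "insert k S - {k} = S" using assms(2)[of k] by auto
  ultimately show ?thesis using excited_Min[of "insert k S"] assms(1) by simp
qed

text \<open>
  Excitations anticommute, so moving \<open>excite k\<close> to its place in the ordered product costs only a sign.
  The induction adds least elements, so that \<open>excite k\<close> has to pass one factor at a time.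
\<close>

lemma excited_insert:
  assumes "finite S" "k \<notin> S"
  shows "\<exists>c. c \<noteq> 0 \<and> excited (insert k S) = scale c (excite k (excited S))"
  using assms
proof (induction S rule: excited_induct)
  case empty
  show ?case using excited_insert_least[of "{}" k] by (intro exI[of _ 1]) simp
next
  case (insert m S)
  show ?case
  proof (cases "k < m")
    case True
    then have "\<And>j. j \<in> insert m S \<Longrightarrow> k < j" using insert.hyps(2) by fastforce
    then show ?thesis using excited_insert_least[of "insert m S" k] insert.hyps(1)
      by (intro exI[of _ 1]) simp
  next
    case False
    with insert.prems have mk: "m < k" by auto
    obtain c where c: "c \<noteq> 0" "excited (insert k S) = scale c (excite k (excited S))"
      using insert by auto
    have "excited (insert m (insert k S)) = excite m (excited (insert k S))"
      using insert.hyps mk by (intro excited_insert_least) auto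
    also have "\<dots> = scale c (excite m (excite k (excited S)))"
      by (simp add: c(2) linear_opD[OF linear_excite])
    also have "\<dots> = scale (- c) (excite k (excite m (excited S)))"
      by (simp add: excite_swap[of m k])
    also have "excite m (excited S) = excited (insert m S)"
      using insert.hyps by (intro excited_insert_least[symmetric]) auto
    finally show ?thesis using c(1) by (intro exI[of _ "- c"]) (simp add: insert_commute)
  qed
qed

lemma excited_remove:
  assumes "finite S" "k \<in> S"
  shows "\<exists>c. c \<noteq> 0 \<and> excited S = scale c (excite k (excited (S - {k})))"
  using excited_insert[of "S - {k}" k] assms by (simp add: insert_absorb)

lemma excite_excited_notin:
  assumes "finite S" "k \<notin> S"
  shows "\<exists>c. c \<noteq> 0 \<and> excite k (excited S) = scale c (excited (insert k S))"
proof -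
  obtain c where "c \<noteq> 0" "excited (insert k S) = scale c (excite k (excited S))"
    using excited_insert[OF assms] by blast
  then show ?thesis by (intro exI[of _ "1 / c"]) simp
qed

lemma excite_excited_in:
  assumes "finite S" "k \<in> S"
  shows "excite k (excited S) = 0"
  using excited_remove[OF assms] by (auto simp: linear_opD[OF linear_excite] excite_twice)

lemma relax_excited_notin:
  assumes "finite S" "k \<notin> S"
  shows "relax k (excited S) = 0"
  using assms
proof (induction S rule: excited_induct)
  case empty
  show ?case by (simp add: excited_empty relax_vac)
next
  case (insert m S)
  then have "relax k (excite m (excited S)) + excite m 0 = 0"
    using relax_excite[of k m "excited S"] by auto
  then show ?case
    using insert.hyps by (simp add: excited_insert_least linear_opD[OF linear_excite])
qed

lemma relax_excited_in:
  assumes "finite S" "k \<in> S"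
  shows "\<exists>c. c \<noteq> 0 \<and> relax k (excited S) = scale c (excited (S - {k}))"
proof -
  obtain c where c: "c \<noteq> 0" "excited S = scale c (excite k (excited (S - {k})))"
    using excited_remove[OF assms] by blast
  have "relax k (excite k (excited (S - {k}))) = excited (S - {k})"
    using relax_excite[of k k "excited (S - {k})"] assms
    by (simp add: relax_excited_notin linear_opD[OF linear_excite])
  then show ?thesis using c by (auto simp: linear_opD[OF linear_relax])
qed

lemma excite_relax_excited:
  assumes "finite S"
  shows "excite k (relax k (excited S)) = (if k \<in> S then excited S else 0)"
  using relax_excite[of k k "excited S"] assms
  by (auto simp: relax_excited_notin excite_excited_in linear_opD[OF linear_excite] linear_opD[OF linear_relax])

lemma relax_excite_excited:
  assumes "finite S"
  shows "relax k (excite k (excited S)) = (if k \<in> S then 0 else excited S)"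
  using relax_excite[of k k "excited S"] assms
  by (auto simp: relax_excited_notin excite_excited_in linear_opD[OF linear_excite] linear_opD[OF linear_relax])

text \<open>
  The annihilation modes take the factors away one by one, down to the vacuum.
\<close>

lemma excited_nonzero:
  assumes "finite S"
  shows "excited S \<noteq> 0"
  using assms
proof (induction S rule: excited_induct)
  case empty
  show ?case by (simp add: excited_empty vac_nonzero)
next
  case (insert k S)
  have "k \<notin> S" using insert.hyps(2)[of k] by auto
  then have "relax k (excited (insert k S)) = excited S"
    using insert.hyps by (simp add: excited_insert_least relax_excite_excited)
  then show ?case using insert.IH by (auto simp: linear_opD[OF linear_relax])
qed

end

section \<open>Combinatorics of Maya diagrams\<close>

definition maya :: "int set \<Rightarrow> bool" where
  "maya M \<longleftrightarrow> finite (sym_diff M {..<0})"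

text \<open>
  The total weight of the filled levels minus that of the negative levels: the divergent sum over \<open>M\<close>,
  normalised to vanish on the vacuum.  The weight \<open>1\<close> gives the charge, and \<open>k + 1/2\<close> the energy.
\<close>

definition level :: "(int \<Rightarrow> 'a::comm_ring_1) \<Rightarrow> int set \<Rightarrow> 'a" where
  "level f M = (\<Sum>k\<in>sym_diff M {..<0}. f k * (of_bool (k \<in> M) - of_bool (k < 0)))"

lemma level_superset:
  assumes "finite K" "sym_diff M {..<0} \<subseteq> K"
  shows "level f M = (\<Sum>k\<in>K. f k * (of_bool (k \<in> M) - of_bool (k < 0)))"
  unfolding level_def using assms by (intro sum.mono_neutral_left) auto

lemma maya_insert: "maya M \<Longrightarrow> maya (insert k M)"
  unfolding maya_def by (rule finite_subset[of _ "insert k (sym_diff M {..<0})"]) auto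

lemma maya_remove: "maya M \<Longrightarrow> maya (M - {k})"
  unfolding maya_def by (rule finite_subset[of _ "insert k (sym_diff M {..<0})"]) auto

lemma level_insert:
  assumes "maya M" "k \<notin> M"
  shows "level f (insert k M) = level f M + f k"
proof -
  let ?K = "insert k (sym_diff M {..<0})"
  have K: "finite ?K" using assms(1) by (simp add: maya_def)
  have "level f (insert k M) = (\<Sum>j\<in>?K. f j * (of_bool (j \<in> insert k M) - of_bool (j < 0)))"
    using K by (intro level_superset) auto
  also have "\<dots> = (\<Sum>j\<in>?K. f j * (of_bool (j \<in> M) - of_bool (j < 0)) + (if j = k then f j else 0))"
    using assms(2) by (intro sum.cong) (auto simp: algebra_simps)
  also have "\<dots> = (\<Sum>j\<in>?K. f j * (of_bool (j \<in> M) - of_bool (j < 0))) + f k"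
    using K by (simp add: sum.distrib)
  also have "(\<Sum>j\<in>?K. f j * (of_bool (j \<in> M) - of_bool (j < 0))) = level f M"
    using K by (intro level_superset[symmetric]) auto
  finally show ?thesis .
qed

lemma level_remove:
  assumes "maya M" "k \<in> M"
  shows "level f (M - {k}) = level f M - f k"
  using level_insert[OF maya_remove[OF assms(1)], of k k f] assms(2)
  by (simp add: insert_absorb)

definition lower :: "int set \<Rightarrow> int set" where
  "lower M = {k. k + 1 \<in> M}"

lemma sym_diff_lower:
  "sym_diff (lower M) {..<0} \<subseteq> (\<lambda>k. k - 1) ` insert 0 (sym_diff M {..<0})"
proof
  fix x assume "x \<in> sym_diff (lower M) {..<0}"
  then have "x + 1 \<in> insert 0 (sym_diff M {..<0})" by (auto simp: lower_def)
  then show "x \<in> (\<lambda>k. k - 1) ` insert 0 (sym_diff M {..<0})"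
    by (rule image_eqI[rotated]) simp
qed

lemma maya_lower: "maya (lower M) \<longleftrightarrow> maya M"
proof
  assume "maya M"
  then show "maya (lower M)"
    unfolding maya_def by (intro finite_subset[OF sym_diff_lower] finite_imageI) simp
next
  assume "maya (lower M)"
  moreover have "sym_diff M {..<0} \<subseteq> insert 0 ((\<lambda>k. k + 1) ` sym_diff (lower M) {..<0})"
  proof
    fix x assume x: "x \<in> sym_diff M {..<0}"
    show "x \<in> insert 0 ((\<lambda>k. k + 1) ` sym_diff (lower M) {..<0})"
    proof (cases "x = 0")
      case False
      then have "x - 1 \<in> sym_diff (lower M) {..<0}" using x by (auto simp: lower_def)
      then show ?thesis by (intro insertI2) (rule image_eqI[rotated], auto)
    qed simp
  qed
  ultimately show "maya M"
    unfolding maya_def by (meson finite_imageI finite_insert finite_subset)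
qed

text \<open>
  Lowering replaces the weight \<open>f k\<close> of a particle by \<open>f (k - 1)\<close>.  It also moves the vacuum, whose levels
  become those below \<open>-1\<close>, and so leaves a hole at level \<open>-1\<close>; this is the correction \<open>f (- 1)\<close>.
\<close>

lemma level_lower:
  assumes "maya M"
  shows "level f (lower M) = level (\<lambda>k. f (k - 1)) M - f (- 1)"
proof -
  let ?K = "insert 0 (sym_diff M {..<0})"
  have K: "finite ?K" using assms by (simp add: maya_def)
  have "level f (lower M) = (\<Sum>j\<in>(\<lambda>k. k - 1) ` ?K. f j * (of_bool (j \<in> lower M) - of_bool (j < 0)))"
    using K by (intro level_superset sym_diff_lower) blast
  also have "\<dots> = (\<Sum>k\<in>?K. f (k - 1) * (of_bool (k \<in> M) - of_bool (k < 1)))"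
    by (subst sum.reindex) (auto simp: lower_def inj_on_def)
  also have "\<dots> = (\<Sum>k\<in>?K. f (k - 1) * (of_bool (k \<in> M) - of_bool (k < 0)) - (if k = 0 then f (- 1) else 0))"
    by (intro sum.cong) (auto simp: algebra_simps)
  also have "\<dots> = (\<Sum>k\<in>?K. f (k - 1) * (of_bool (k \<in> M) - of_bool (k < 0))) - f (- 1)"
    using K by (simp add: sum_subtractf)
  also have "(\<Sum>k\<in>?K. f (k - 1) * (of_bool (k \<in> M) - of_bool (k < 0))) = level (\<lambda>k. f (k - 1)) M"
    using K by (intro level_superset[symmetric]) auto
  finally show ?thesis .
qed

definition charge :: "int set \<Rightarrow> int" where
  "charge = level (\<lambda>_. 1)"

lemma charge_vacuum: "charge {..<0} = 0"
  by (simp add: charge_def level_def)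

definition energy :: "int set \<Rightarrow> rat" where
  "energy = level (\<lambda>k. of_int k + 1/2)"

lemma of_rat_energy: "of_rat (energy M) = (level (\<lambda>k. of_int k + 1/2) M :: complex)"
proof -
  have "of_rat (of_bool p) = (of_bool p :: complex)" for p by (cases p) auto
  then show ?thesis
    unfolding energy_def level_def
    by (simp add: of_rat_sum of_rat_mult of_rat_add of_rat_diff of_rat_divide)
qed

lemma energy_summand_nonneg:
  "(0::rat) \<le> (of_int k + 1/2) * (of_bool (k \<in> M) - of_bool (k < 0))"
proof (cases "k \<ge> 0")
  case False
  then have "of_int k \<le> (- 1 :: rat)" by linarith
  then show ?thesis using False by (auto simp: mult_le_0_iff)
qed auto

lemma energy_nonneg: "energy M \<ge> 0"
  unfolding energy_def level_def by (intro sum_nonneg energy_summand_nonneg)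

text \<open>
  Each excited level \<open>k\<close> contributes \<open>\<bar>k + 1/2\<bar>\<close> to the energy, which bounds the excited levels.
\<close>

lemma finite_energy: "finite {M. maya M \<and> energy M = s}"
proof -
  let ?K = "{k :: int. \<bar>k\<bar> \<le> \<lceil>\<bar>s\<bar>\<rceil> + 1}"
  have mem: "M \<in> (\<lambda>S. sym_diff S {..<0}) ` Pow ?K" if M: "maya M" "energy M = s" for M
  proof (rule image_eqI)
    show "sym_diff M {..<0} \<in> Pow ?K"
    proof (intro PowI subsetI CollectI)
      fix k assume k: "k \<in> sym_diff M {..<0}"
      have "(of_int k + 1/2) * (of_bool (k \<in> M) - of_bool (k < 0)) \<le> energy M"
        unfolding energy_def level_def
        by (rule member_le_sum[OF k]) (use M(1) energy_summand_nonneg in \<open>auto simp: maya_def\<close>)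
      moreover have "(of_int k + 1/2) * (of_bool (k \<in> M) - of_bool (k < 0)) = \<bar>of_int k + 1/2 :: rat\<bar>"
      proof (cases "k \<ge> 0")
        case False
        then have "of_int k \<le> (- 1 :: rat)" by linarith
        then show ?thesis using False k by auto
      qed (use k in auto)
      ultimately have "\<bar>of_int k + 1/2\<bar> \<le> s" using M(2) by simp
      then show "\<bar>k\<bar> \<le> \<lceil>\<bar>s\<bar>\<rceil> + 1" by linarith
    qed
  qed auto
  have "finite ?K"
    by (rule finite_subset[of _ "{- (\<lceil>\<bar>s\<bar>\<rceil> + 1)..\<lceil>\<bar>s\<bar>\<rceil> + 1}"]) auto
  then have "finite ((\<lambda>S. sym_diff S {..<0}) ` Pow ?K)" by simp
  then show ?thesis by (rule finite_subset[rotated]) (use mem in auto)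
qed

lemma charge_insert: "maya M \<Longrightarrow> k \<notin> M \<Longrightarrow> charge (insert k M) = charge M + 1"
  and energy_insert: "maya M \<Longrightarrow> k \<notin> M \<Longrightarrow> energy (insert k M) = energy M + of_int k + 1/2"
  by (simp_all add: charge_def energy_def level_insert)

lemma charge_lower: "maya M \<Longrightarrow> charge (lower M) = charge M - 1"
  by (simp add: charge_def level_lower)

lemma energy_lower:
  assumes "maya M"
  shows "energy (lower M) = energy M - of_int (charge M) + 1/2"
proof -
  have "level (\<lambda>k. of_int (k - 1) + 1/2) M = energy M - of_int (charge M)"
    unfolding energy_def charge_def level_def of_int_sum sum_subtractf[symmetric]
    by (intro sum.cong) (auto simp: algebra_simps)
  then show ?thesis unfolding energy_def by (subst level_lower[OF assms]) simp
qed

definition diagrams :: "rat \<Rightarrow> int set set" where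
  "diagrams s = {M. maya M \<and> charge M = 0 \<and> energy M = s}"

lemma finite_diagrams [simp]: "finite (diagrams s)"
  by (rule finite_subset[OF _ finite_energy[of s]]) (auto simp: diagrams_def)

text \<open>
  Filling level \<open>a\<close> adds \<open>1\<close> to the charge and \<open>a + 1/2\<close> to the energy; lowering
  a diagram of charge \<open>1\<close> subtracts \<open>1\<close> from the charge and \<open>1/2\<close> from the energy.  The composition therefore
  preserves charge \<open>0\<close> and raises the energy by \<open>a\<close>.
\<close>

lemma card_fill_and_lower:
  assumes "a \<noteq> b"
  shows "card {M \<in> diagrams s. a \<notin> M \<and> b \<in> M} =
         card {M \<in> diagrams (s + of_int a). a - 1 \<in> M \<and> b - 1 \<in> M}"
proof (rule bij_betw_same_card)
  let ?up = "\<lambda>M. {k. k - 1 \<in> M}"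
  have lower_up: "lower (?up M) = M" and up_lower: "?up (lower M) = M" for M
    by (auto simp: lower_def)
  show "bij_betw (\<lambda>M. lower (insert a M)) {M \<in> diagrams s. a \<notin> M \<and> b \<in> M}
          {M \<in> diagrams (s + of_int a). a - 1 \<in> M \<and> b - 1 \<in> M}"
  proof (rule bij_betwI[of _ _ _ "\<lambda>M. ?up M - {a}"])
    show "(\<lambda>M. lower (insert a M)) \<in> {M \<in> diagrams s. a \<notin> M \<and> b \<in> M} \<rightarrow>
        {M \<in> diagrams (s + of_int a). a - 1 \<in> M \<and> b - 1 \<in> M}"
    proof
      fix M assume M: "M \<in> {M \<in> diagrams s. a \<notin> M \<and> b \<in> M}"
      then have "maya (lower (insert a M))" "charge (lower (insert a M)) = 0"
        "energy (lower (insert a M)) = s + of_int a"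
        by (auto simp: diagrams_def maya_lower maya_insert charge_lower energy_lower
            charge_insert energy_insert)
      then show "lower (insert a M) \<in> {M \<in> diagrams (s + of_int a). a - 1 \<in> M \<and> b - 1 \<in> M}"
        using M by (auto simp: diagrams_def lower_def)
    qed
    show "(\<lambda>M. ?up M - {a}) \<in> {M \<in> diagrams (s + of_int a). a - 1 \<in> M \<and> b - 1 \<in> M} \<rightarrow>
        {M \<in> diagrams s. a \<notin> M \<and> b \<in> M}"
    proof
      fix M assume M: "M \<in> {M \<in> diagrams (s + of_int a). a - 1 \<in> M \<and> b - 1 \<in> M}"
      define N where "N = ?up M - {a}"
      have ins: "insert a N = ?up M" "a \<notin> N" using M by (auto simp: N_def)
      then have low: "lower (insert a N) = M" by (simp add: lower_up)
      have "maya (insert a N)" using M low maya_lower[of "insert a N"] by (auto simp: diagrams_def)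
      then have N: "maya N" using maya_remove[of "insert a N" a] ins(2) by simp
      then have "charge N = 0" "energy N = s"
        using M charge_lower[of "insert a N"] energy_lower[of "insert a N"]
          charge_insert[OF N ins(2)] energy_insert[OF N ins(2)]
        by (auto simp: diagrams_def low maya_insert)
      moreover have "b \<in> N" using M assms by (simp add: N_def)
      ultimately show "?up M - {a} \<in> {M \<in> diagrams s. a \<notin> M \<and> b \<in> M}"
        using N ins(2) by (simp add: diagrams_def N_def)
    qed
    show "?up (lower (insert a M)) - {a} = M"
      if "M \<in> {M \<in> diagrams s. a \<notin> M \<and> b \<in> M}" for M
      using that by (auto simp: up_lower)
    show "lower (insert a (?up M - {a})) = M"
      if "M \<in> {M \<in> diagrams (s + of_int a). a - 1 \<in> M \<and> b - 1 \<in> M}" for M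
      using that by (auto simp: lower_def)
  qed
qed

section \<open>Maya diagrams as a basis of the Fock space\<close>

context charged_fermion_fock
begin

text \<open>
  The excited levels of a diagram are those where it differs from the vacuum.
\<close>

definition state :: "int set \<Rightarrow> 'v" where
  "state M = excited (sym_diff M {..<0})"

lemma state_vac: "state {..<0} = vac"
  by (simp add: state_def excited_empty)

lemma state_nonzero: "maya M \<Longrightarrow> state M \<noteq> 0"
  by (simp add: state_def maya_def excited_nonzero)

lemma occupy_vacate_state:
  assumes "maya M"
  shows "occupy k (vacate k (state M)) = (if k \<in> M then state M else 0)"
    and "vacate k (occupy k (state M)) = (if k \<in> M then 0 else state M)"
  using assms excite_relax_excited[of "sym_diff M {..<0}" k] relax_excite_excited[of "sym_diff M {..<0}" k]
  by (auto simp: state_def maya_def excite_def relax_def split: if_splits)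

lemma occupy_state_in: "maya M \<Longrightarrow> k \<in> M \<Longrightarrow> occupy k (state M) = 0"
  using excite_excited_in[of "sym_diff M {..<0}" k] relax_excited_notin[of "sym_diff M {..<0}" k]
  by (auto simp: state_def maya_def excite_def relax_def split: if_splits)

lemma vacate_state_notin: "maya M \<Longrightarrow> k \<notin> M \<Longrightarrow> vacate k (state M) = 0"
  using excite_excited_in[of "sym_diff M {..<0}" k] relax_excited_notin[of "sym_diff M {..<0}" k]
  by (auto simp: state_def maya_def excite_def relax_def split: if_splits)

lemma occupy_state_notin:
  assumes "maya M" "k \<notin> M"
  shows "\<exists>c. c \<noteq> 0 \<and> occupy k (state M) = scale c (state (insert k M))"
proof (cases "k \<ge> 0")
  case True
  have "sym_diff (insert k M) {..<0} = insert k (sym_diff M {..<0})" using True by auto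
  then show ?thesis
    using excite_excited_notin[of "sym_diff M {..<0}" k] True assms
    by (simp add: state_def maya_def excite_def)
next
  case False
  have "sym_diff (insert k M) {..<0} = sym_diff M {..<0} - {k}" using False by auto
  then show ?thesis
    using relax_excited_in[of "sym_diff M {..<0}" k] False assms
    by (simp add: state_def maya_def relax_def)
qed

lemma vacate_state_in:
  assumes "maya M" "k \<in> M"
  shows "\<exists>c. c \<noteq> 0 \<and> vacate k (state M) = scale c (state (M - {k}))"
proof (cases "k \<ge> 0")
  case True
  have "sym_diff (M - {k}) {..<0} = sym_diff M {..<0} - {k}" using True by auto
  then show ?thesis
    using relax_excited_in[of "sym_diff M {..<0}" k] True assms
    by (simp add: state_def maya_def relax_def)
next
  case False
  have "sym_diff (M - {k}) {..<0} = insert k (sym_diff M {..<0})" using False assms by auto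
  then show ?thesis
    using excite_excited_notin[of "sym_diff M {..<0}" k] False assms
    by (simp add: state_def maya_def excite_def)
qed

text \<open>
  The operators \<^term>\<open>\<lambda>v. occupy k (vacate k v)\<close> test whether level \<open>k\<close> is filled, and two different
  diagrams differ at some level.
\<close>

lemma state_independent: "independent_family state {M. maya M}"
proof (rule separated_family_independent[where N = "\<lambda>k v. occupy k (vacate k v)" and P = "\<lambda>k M. k \<in> M"])
  show "Vector_Spaces.linear scale scale (\<lambda>v. occupy k (vacate k v))" for k
    by (rule linear_opI) (simp_all add: linear_opD[OF linear_occupy] linear_opD[OF linear_vacate])
qed (auto simp: state_nonzero occupy_vacate_state)

lemma half_intsE:
  assumes "n \<in> half_ints"
  obtains k where "n = of_int k + 1/2" "psi n = occupy (- k - 1)" "psis n = vacate k"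
  using assms that by (auto simp: half_ints_def occupy_def vacate_def psi_field_def psis_field_def)

text \<open>
  Every mode sends a basis vector to a multiple of a basis vector, with the expected change of charge,
  or to zero.  The charge of the monomial is then no longer visible, hence the alternative \<open>v = 0\<close>.
\<close>

lemma charge_monomial_state:
  assumes "(m, v) \<in> charge_monomials psi psis vac"
  shows "\<exists>c M. v = scale c (state M) \<and> maya M \<and> (v = 0 \<or> charge M = m)"
  using assms
proof (induction rule: charge_monomials.induct)
  case 1
  show ?case
    by (intro exI[of _ 1] exI[of _ "{..<0}"]) (simp add: state_vac maya_def charge_vacuum)
next
  case (2 m v n)
  obtain k where k: "psi n = occupy k" using half_intsE[OF 2(2)] by metis
  obtain c M where M: "v = scale c (state M)" "maya M" "v = 0 \<or> charge M = m" using 2(3) by blast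
  have zero: "?case" if "psi n v = 0"
    using that M(2) by (intro exI[of _ 0] exI[of _ M]) simp
  show ?case
  proof (cases "k \<in> M \<or> v = 0")
    case True
    then have "psi n v = 0" by (auto simp: k M occupy_state_in linear_opD[OF linear_occupy])
    then show ?thesis by (rule zero)
  next
    case False
    then obtain d where "occupy k (state M) = scale d (state (insert k M))"
      using occupy_state_notin[of M k] M by auto
    then show ?thesis
      using False M
      by (intro exI[of _ "c * d"] exI[of _ "insert k M"])
        (auto simp: k linear_opD[OF linear_occupy] maya_insert charge_def level_insert)
  qed
next
  case (3 m v n)
  obtain k where k: "psis n = vacate k" using half_intsE[OF 3(2)] by metis
  obtain c M where M: "v = scale c (state M)" "maya M" "v = 0 \<or> charge M = m" using 3(3) by blast
  have zero: "?case" if "psis n v = 0"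
    using that M(2) by (intro exI[of _ 0] exI[of _ M]) simp
  show ?case
  proof (cases "k \<notin> M \<or> v = 0")
    case True
    then have "psis n v = 0" by (auto simp: k M vacate_state_notin linear_opD[OF linear_vacate])
    then show ?thesis by (rule zero)
  next
    case False
    then obtain d where "vacate k (state M) = scale d (state (M - {k}))"
      using vacate_state_in[of M k] M by auto
    then show ?thesis
      using False M
      by (intro exI[of _ "c * d"] exI[of _ "M - {k}"])
        (auto simp: k linear_opD[OF linear_vacate] maya_remove charge_def level_remove)
  qed
qed

lemma charge_monomials_excite:
  assumes "(m, v) \<in> charge_monomials psi psis vac"
  shows "(m + (if k \<ge> 0 then 1 else - 1), excite k v) \<in> charge_monomials psi psis vac"
proof (cases "k \<ge> 0")
  case True
  have "(m + 1, occupy k v) \<in> charge_monomials psi psis vac"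
    unfolding occupy_def psi_field_def by (intro charge_monomials.intros(2) assms half_ints_of_int)
  with True show ?thesis by (simp add: excite_def)
next
  case False
  have "(m - 1, vacate k v) \<in> charge_monomials psi psis vac"
    unfolding vacate_def psis_field_def by (intro charge_monomials.intros(3) assms half_ints_of_int)
  with False show ?thesis by (simp add: excite_def)
qed

lemma excited_charge_monomial:
  assumes "finite S"
  shows "((\<Sum>k\<in>S. if k \<ge> 0 then 1 else - 1), excited S) \<in> charge_monomials psi psis vac"
  using assms
proof (induction S rule: excited_induct)
  case empty
  show ?case using charge_monomials.intros(1) by (simp add: excited_empty)
next
  case (insert k S)
  have "k \<notin> S" using insert.hyps(2)[of k] by auto
  then show ?case
    using charge_monomials_excite[OF insert.IH, of k] insert.hyps
    by (simp add: excited_insert_least add.commute)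
qed

lemma state_charge_monomial:
  assumes "maya M"
  shows "(charge M, state M) \<in> charge_monomials psi psis vac"
proof -
  have "charge M = (\<Sum>k\<in>sym_diff M {..<0}. if k \<ge> 0 then 1 else - 1)"
    unfolding charge_def level_def by (intro sum.cong) auto
  then show ?thesis
    using excited_charge_monomial[of "sym_diff M {..<0}"] assms by (simp add: maya_def state_def)
qed

lemma charge_space_span: "charge_space m = span (state ` {M. maya M \<and> charge M = m})"
proof (rule subset_antisym)
  have "v \<in> span (state ` {M. maya M \<and> charge M = m})"
    if v: "(m, v) \<in> charge_monomials psi psis vac" for v
  proof (cases "v = 0")
    case False
    then obtain c M where "v = scale c (state M)" "maya M" "charge M = m"
      using charge_monomial_state[OF v] by blast
    then show ?thesis by (simp add: span_scale span_base)
  qed (simp add: span_zero)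
  then show "charge_space m \<subseteq> span (state ` {M. maya M \<and> charge M = m})"
    unfolding charge_space_def by (intro span_minimal subspace_span) auto
  show "span (state ` {M. maya M \<and> charge M = m}) \<subseteq> charge_space m"
    unfolding charge_space_def by (rule span_mono) (use state_charge_monomial in auto)
qed

lemma state_span: "span (state ` {M. maya M}) = UNIV"
proof -
  have "v \<in> span (state ` {M. maya M})" if "(m, v) \<in> charge_monomials psi psis vac" for m v
    using charge_monomial_state[OF that] by (auto simp: span_scale span_base)
  then have "snd ` charge_monomials psi psis vac \<subseteq> span (state ` {M. maya M})" by auto
  then show ?thesis using generated span_minimal[OF _ subspace_span] by blast
qed

text \<open>
  For the infinite sums of modes in \<open>L(0)\<close>: an operator \<open>T k\<close> that is \<open>f k\<close> times the normally ordered
  occupation number of level \<open>k\<close> vanishes on \<^term>\<open>state M\<close> unless \<open>k\<close> is excited.  So on each vector the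
  sum is finite, and it acts on \<^term>\<open>state M\<close> as \<^term>\<open>level f M\<close>.
\<close>

lemma mode_sum_diagonal:
  assumes lin: "\<And>k. Vector_Spaces.linear scale scale (T k)"
    and T: "\<And>k M. maya M \<Longrightarrow> T k (state M) = scale (f k * (of_bool (k \<in> M) - of_bool (k < 0))) (state M)"
  shows "Vector_Spaces.linear scale scale (\<lambda>v. Sum_any (\<lambda>k. T k v))"
    and "maya M \<Longrightarrow> Sum_any (\<lambda>k. T k (state M)) = scale (level f M) (state M)"
proof -
  have zero: "{k. T k (state M) \<noteq> 0} \<subseteq> sym_diff M {..<0}" if "maya M" for M
    using T[OF that] by auto
  have "finite {k. T k v \<noteq> 0}" for v
  proof -
    have "v \<in> span (state ` {M. maya M})" by (simp add: state_span)
    then show ?thesis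
    proof (induction rule: span_induct_alt)
      case base
      show ?case by (simp add: linear_opD[OF lin])
    next
      case (step c x y)
      then have "finite {k. T k x \<noteq> 0}"
        using finite_subset[OF zero] by (auto simp: maya_def)
      then have "finite ({k. T k x \<noteq> 0} \<union> {k. T k y \<noteq> 0})" using step by simp
      then show ?case by (rule rev_finite_subset) (auto simp: linear_opD[OF lin])
    qed
  qed
  then show "Vector_Spaces.linear scale scale (\<lambda>v. Sum_any (\<lambda>k. T k v))"
    by (rule linear_op_Sum_any[OF lin])
  show "Sum_any (\<lambda>k. T k (state M)) = scale (level f M) (state M)" if M: "maya M"
  proof -
    have "Sum_any (\<lambda>k. T k (state M)) = (\<Sum>k\<in>sym_diff M {..<0}. T k (state M))"
      using M zero[OF M] by (intro Sum_any.expand_superset) (auto simp: maya_def)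
    then show ?thesis by (simp add: T M level_def scale_sum_left)
  qed
qed

text \<open>
  The modes of \<open>:\<partial>\<psi>\<^sup>*(x)\<psi>(x):\<close> and \<open>:\<partial>\<psi>(x)\<psi>\<^sup>*(x):\<close> that enter \<open>L(0)\<close>, reindexed by the level they act
  on (\<open>j = k + 1\<close> and \<open>j = - k\<close>).
\<close>

lemma normal_ordered_1:
  "normal_ordered (deriv_field psis_field) psi_field 1 v =
     Sum_any (\<lambda>k. if k < - 1 then scale (- (of_int k + 1)) (vacate k (occupy k v))
                 else scale (of_int k + 1) (occupy k (vacate k v)))" (is ?psis)
  "normal_ordered (deriv_field psi_field) psis_field 1 v =
     Sum_any (\<lambda>k. if k > 0 then scale (of_int k) (occupy k (vacate k v))
                 else scale (- of_int k) (vacate k (occupy k v)))" (is ?psi)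
proof -
  have scale_psi: "psi_field n (scale c w) = scale c (psi_field n w)" for n c w
    using linear_opD(2)[OF linear_occupy[of "- n - 1"]] by (simp add: occupy_def)
  have scale_psis: "psis_field n (scale c w) = scale c (psis_field n w)" for n c w
    using linear_opD(2)[OF linear_vacate[of n]] by (simp add: vacate_def)
  have "bij (\<lambda>k :: int. k + 1)" by (rule bij_betwI[of _ _ _ "\<lambda>k. k - 1"]) auto
  then show ?psis
    unfolding normal_ordered_def
    by (rule Sum_any.reindex_cong)
      (auto simp: fun_eq_iff deriv_field_def occupy_def vacate_def scale_psi scale_psis
        scale_minus_left[symmetric] simp del: scale_minus_left)
  have "bij (\<lambda>k :: int. - k)" by (rule bij_betwI[of _ _ _ "\<lambda>k. - k"]) auto
  then show ?psi
    unfolding normal_ordered_def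
    by (rule Sum_any.reindex_cong)
      (auto simp: fun_eq_iff deriv_field_def occupy_def vacate_def scale_psi scale_psis)
qed

text \<open>
  The two halves of \<open>\<omega>\<close> weight level \<open>k\<close> by \<open>k + 1\<close> and by \<open>k\<close>; their mean is \<open>k + 1/2\<close>.
\<close>

lemma
  shows linear_L0: "Vector_Spaces.linear scale scale (L 0)"
    and L0_state: "maya M \<Longrightarrow> L 0 (state M) = scale (of_rat (energy M)) (state M)"
proof -
  define T1 where "T1 = (\<lambda>k v. if k < - 1 then scale (- (of_int k + 1)) (vacate k (occupy k v))
                 else scale (of_int k + 1) (occupy k (vacate k v)))"
  define T2 where "T2 = (\<lambda>k v. if k > 0 then scale (of_int k) (occupy k (vacate k v))
                 else scale (- of_int k) (vacate k (occupy k v)))"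
  have lin: "Vector_Spaces.linear scale scale (T1 k)" "Vector_Spaces.linear scale scale (T2 k)" for k
    by (rule linear_opI; simp add: T1_def T2_def linear_opD[OF linear_occupy] linear_opD[OF linear_vacate]
        scale_right_distrib mult.commute)+
  have T1_state: "T1 k (state M) = scale ((of_int k + 1) * (of_bool (k \<in> M) - of_bool (k < 0))) (state M)"
    and T2_state: "T2 k (state M) = scale (of_int k * (of_bool (k \<in> M) - of_bool (k < 0))) (state M)"
    if "maya M" for k M
  proof -
    consider "k < - 1" | "k = - 1" | "k = 0" | "k > 0" by linarith
    then show "T1 k (state M) = scale ((of_int k + 1) * (of_bool (k \<in> M) - of_bool (k < 0))) (state M)"
      "T2 k (state M) = scale (of_int k * (of_bool (k \<in> M) - of_bool (k < 0))) (state M)"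
      by cases (auto simp: T1_def T2_def occupy_vacate_state that)
  qed
  have L0: "L 0 v = scale (1/2) (Sum_any (\<lambda>k. T1 k v)) + scale (1/2) (Sum_any (\<lambda>k. T2 k v))" for v
    by (simp only: L_def omega_field_def add_0 normal_ordered_1 T1_def T2_def)
  show "Vector_Spaces.linear scale scale (L 0)"
    by (rule linear_opI)
      (simp_all only: L0 linear_opD[OF mode_sum_diagonal(1)[OF lin(1) T1_state]]
        linear_opD[OF mode_sum_diagonal(1)[OF lin(2) T2_state]] scale_right_distrib scale_scale mult.commute
        add_ac)
  show "L 0 (state M) = scale (of_rat (energy M)) (state M)" if M: "maya M"
  proof -
    have "L 0 (state M) = scale ((level (\<lambda>k. of_int k + 1) M + level (\<lambda>k. of_int k) M) / 2) (state M)"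
      by (simp only: L0 mode_sum_diagonal(2)[OF lin(1) T1_state M] mode_sum_diagonal(2)[OF lin(2) T2_state M])
        (simp add: add_divide_distrib scale_left_distrib)
    also have "(level (\<lambda>k. of_int k + 1) M + level (\<lambda>k. of_int k) M) / 2 = (of_rat (energy M) :: complex)"
      unfolding of_rat_energy level_def sum.distrib[symmetric] sum_divide_distrib
      by (intro sum.cong) (auto simp: field_simps)
    finally show ?thesis .
  qed
qed

end

section \<open>Graded traces as numbers of Maya diagrams\<close>

lemma minus_half_ints: "- a \<in> half_ints \<longleftrightarrow> a \<in> half_ints"
proof -
  have "- a \<in> half_ints" if a: "a \<in> half_ints" for a
  proof -
    obtain k where "a = of_int k + 1/2" using a by (auto simp: half_ints_def)
    then have "- a = of_int (- k - 1) + 1/2" by simp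
    then show ?thesis by (simp only: half_ints_of_int)
  qed
  from this[of a] this[of "- a"] show ?thesis by auto
qed

lemma half_ints_minus_1: "a - 1 \<in> half_ints \<longleftrightarrow> a \<in> half_ints"
proof
  assume "a - 1 \<in> half_ints"
  then obtain k where "a - 1 = of_int k + 1/2" unfolding half_ints_def by blast
  then have "a = of_int (k + 1) + 1/2" by (simp add: diff_eq_eq)
  then show "a \<in> half_ints" by (simp only: half_ints_of_int)
next
  assume "a \<in> half_ints"
  then obtain k where "a = of_int k + 1/2" unfolding half_ints_def by blast
  then have "a - 1 = of_int (k - 1) + 1/2" by simp
  then show "a - 1 \<in> half_ints" by (simp only: half_ints_of_int)
qed

context charged_fermion_fock
begin

lemma trace_on_diagonal:
  assumes J: "finite J" "J \<subseteq> {M. maya M}"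
    and T: "Vector_Spaces.linear scale scale T" "\<And>M. M \<in> J \<Longrightarrow> T (state M) = scale (f M) (state M)"
  shows "trace_on (span (state ` J)) T = (\<Sum>M\<in>J. f M)"
proof -
  have ind: "independent_family state J"
    using independent_family_subset[OF state_independent J(2)] .
  have inj: "inj_on state J" by (rule independent_family_inj[OF ind])
  have C: "independent (state ` J)" "finite (state ` J)"
    using independent_family_independent[OF ind] J(1) by simp_all
  define B where "B = (SOME B. independent B \<and> span B = span (state ` J))"
  have B: "independent B" "span B = span (state ` J)"
    using someI[of "\<lambda>B. independent B \<and> span B = span (state ` J)" "state ` J"] C
    by (auto simp: B_def)
  have "finite B"
    using independent_span_bound[OF C(2) B(1)] B(2) span_superset by blast
  have closed: "T v \<in> span (state ` J)" if "v \<in> span (state ` J)" for v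
    using that
  proof (induction rule: span_induct_alt)
    case (step c x y)
    then obtain M where "M \<in> J" "x = state M" by auto
    then have "T x \<in> span (state ` J)" by (simp add: T(2) span_scale span_base)
    then show ?case using step by (simp add: linear_opD[OF T(1)] span_add span_scale)
  qed (simp add: linear_opD[OF T(1)] span_zero)
  have "trace_on (span (state ` J)) T = (\<Sum>b\<in>B. representation B (T b) b)"
    by (simp add: trace_on_def B_def Let_def)
  also have "\<dots> = (\<Sum>b\<in>state ` J. representation (state ` J) (T b) b)"
    using B C closed \<open>finite B\<close> T(1) by (intro diagonal_sum_basis_independent) auto
  also have "\<dots> = (\<Sum>M\<in>J. representation (state ` J) (T (state M)) (state M))"
    using inj by (simp add: sum.reindex)
  also have "\<dots> = (\<Sum>M\<in>J. f M)"
  proof (intro sum.cong refl)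
    fix M assume M: "M \<in> J"
    then have "representation (state ` J) (scale (f M) (state M)) (state M) = f M * 1"
      using C by (subst representation_scale) (auto simp: span_base representation_basis)
    then show "representation (state ` J) (T (state M)) (state M) = f M" using M by (simp add: T(2))
  qed
  finally show ?thesis .
qed

text \<open>
  The coefficient of \<open>q\<^sup>r\<close> belongs to \<open>L(0)\<close>-eigenvalue \<open>r + 1/24\<close>, because of the shift in \<^const>\<open>Lbar0\<close>.
\<close>

lemma graded_piece:
  "{v \<in> charge_space 0. Lbar0 v = scale (of_rat r) v} = span (state ` diagrams (r + 1/24))"
proof -
  let ?I = "{M. maya M \<and> charge M = 0}"
  have ind: "independent_family state ?I"
    by (rule independent_family_subset[OF state_independent]) auto
  have "Lbar0 v = scale (of_rat r) v \<longleftrightarrow> L 0 v = scale (of_rat (r + 1/24)) v" for v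
    by (auto simp: Lbar0_def of_rat_add of_rat_divide scale_left_distrib diff_eq_eq)
  then have "{v \<in> charge_space 0. Lbar0 v = scale (of_rat r) v} =
      {v \<in> span (state ` ?I). L 0 v = scale (of_rat (r + 1/24)) v}"
    by (simp add: charge_space_span)
  also have "\<dots> = span (state ` {M \<in> ?I. (of_rat (energy M) :: complex) = of_rat (r + 1/24)})"
    by (rule diagonal_eigenspace[OF ind linear_L0]) (simp add: L0_state)
  also have "{M \<in> ?I. (of_rat (energy M) :: complex) = of_rat (r + 1/24)} = diagrams (r + 1/24)"
    by (auto simp: diagrams_def simp del: of_rat_add)
  finally show ?thesis .
qed

text \<open>
  In the coefficient of \<open>t\<^sup>a x\<^sup>0\<close>, the exponent of \<open>t\<close> determines the mode of \<open>\<psi>\<close>, and then that of \<open>\<psi>\<^sup>*\<close>.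
\<close>

lemma o_XX_eq: "o_XX a v = (if a \<in> half_ints then psi (- a) (psis a v) else 0)"
proof -
  have "Sum_any (\<lambda>b. X_psi (a, b) (X_psis (0 - b) v)) =
      Sum_any (\<lambda>b. if b = a then if a \<in> half_ints then psi (- a) (psis a v) else 0 else 0)"
    by (rule Sum_any.cong) (simp add: X_psi_def X_psis_def minus_half_ints)
  then show ?thesis by (simp add: o_XX_def XX_def)
qed

lemma o_XX_half: "o_XX (of_int k + 1/2) v = occupy k (vacate k v)"
proof -
  have "- (of_int k + 1/2 :: rat) = of_int (- k - 1) + 1/2" by simp
  then show ?thesis
    by (simp only: o_XX_eq half_ints_of_int if_True occupy_def vacate_def psi_field_def psis_field_def)
qed

text \<open>
  Levels as they are labelled in the variables \<open>t\<^sub>i\<close>: exponent \<open>k + 1/2\<close> for level \<open>k\<close>.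
\<close>

definition holds :: "int set \<Rightarrow> rat \<Rightarrow> bool" where
  "holds M a \<longleftrightarrow> (\<exists>k\<in>M. a = of_int k + 1/2)"

lemma linear_o_XX: "Vector_Spaces.linear scale scale (o_XX a)"
proof (cases "a \<in> half_ints")
  case True
  then obtain k where k: "a = of_int k + 1/2" by (auto simp: half_ints_def)
  show ?thesis
    by (rule linear_opI) (simp_all add: k o_XX_half linear_opD[OF linear_occupy] linear_opD[OF linear_vacate])
qed (auto intro!: linear_opI simp: o_XX_eq)

lemma o_XX_state: "maya M \<Longrightarrow> o_XX a (state M) = (if holds M a then state M else 0)"
proof (cases "a \<in> half_ints")
  case True
  then obtain k where k: "a = of_int k + 1/2" by (auto simp: half_ints_def)
  assume "maya M"
  then show ?thesis by (simp add: k o_XX_half occupy_vacate_state holds_def)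
qed (auto simp: o_XX_eq holds_def)

lemma
  shows linear_o_XX_word: "Vector_Spaces.linear scale scale (foldr (\<circ>) (map o_XX as) id)"
    and o_XX_word_state: "maya M \<Longrightarrow> foldr (\<circ>) (map o_XX as) id (state M) =
           scale (of_bool (\<forall>a\<in>set as. holds M a)) (state M)"
proof (induction as)
  case Nil
  show "Vector_Spaces.linear scale scale (foldr (\<circ>) (map o_XX []) id)" by (rule linear_opI) auto
  show "foldr (\<circ>) (map o_XX []) id (state M) = scale (of_bool (\<forall>a\<in>set []. holds M a)) (state M)" by simp
next
  case (Cons a as)
  have step: "foldr (\<circ>) (map o_XX (a # as)) id v = o_XX a (foldr (\<circ>) (map o_XX as) id v)" for v
    by simp
  show "Vector_Spaces.linear scale scale (foldr (\<circ>) (map o_XX (a # as)) id)"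
    by (rule linear_opI) (simp_all only: step linear_opD[OF Cons(1)] linear_opD[OF linear_o_XX])
  show "foldr (\<circ>) (map o_XX (a # as)) id (state M) = scale (of_bool (\<forall>a\<in>set (a # as). holds M a)) (state M)"
    if M: "maya M"
    unfolding step Cons(2)[OF M] linear_opD[OF linear_o_XX] o_XX_state[OF M] by auto
qed

lemma graded_trace_card:
  "graded_trace 0 (foldr (\<circ>) (map o_XX as) id) r =
     of_nat (card {M \<in> diagrams (r + 1/24). \<forall>a\<in>set as. holds M a})"
proof -
  have "graded_trace 0 (foldr (\<circ>) (map o_XX as) id) r =
      (\<Sum>M\<in>diagrams (r + 1/24). of_bool (\<forall>a\<in>set as. holds M a))"
    unfolding graded_trace_def graded_piece
  proof (rule trace_on_diagonal[OF finite_diagrams _ linear_o_XX_word])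
    show "diagrams (r + 1/24) \<subseteq> {M. maya M}" by (auto simp: diagrams_def)
  qed (auto simp: diagrams_def o_XX_word_state)
  also have "\<dots> = of_nat (card {M \<in> diagrams (r + 1/24). \<forall>a\<in>set as. holds M a})"
    by (simp add: sum_of_bool_eq Int_def)
  finally show ?thesis .
qed

text \<open>
  The diagrams with \<open>b\<close> filled are split according to whether \<open>a\<close> is filled, and \<open>card_fill_and_lower\<close>
  is applied to those with \<open>a\<close> empty.  If \<open>b\<close> is not a half-integer, all terms vanish.
\<close>

lemma graded_trace_recursion:
  assumes "a \<in> half_ints" "a \<noteq> b"
  shows "graded_trace 0 (foldr (\<circ>) (map o_XX [b]) id) r =
         graded_trace 0 (foldr (\<circ>) (map o_XX [a, b]) id) r +
         graded_trace 0 (foldr (\<circ>) (map o_XX [a - 1, b - 1]) id) (r + a - 1/2)"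
proof -
  obtain i where i: "a = of_int i + 1/2" using assms(1) by (auto simp: half_ints_def)
  let ?D = "diagrams (r + 1/24)"
  have shift: "holds M (c - 1) \<longleftrightarrow> (\<exists>k. c = of_int k + 1/2 \<and> k - 1 \<in> M)" for M c
  proof
    assume "holds M (c - 1)"
    then obtain k where "k \<in> M" "c - 1 = of_int k + 1/2" by (auto simp: holds_def)
    then show "\<exists>k. c = of_int k + 1/2 \<and> k - 1 \<in> M" by (intro exI[of _ "k + 1"]) simp
  next
    assume "\<exists>k. c = of_int k + 1/2 \<and> k - 1 \<in> M"
    then obtain k where "c = of_int k + 1/2" "k - 1 \<in> M" by blast
    then show "holds M (c - 1)" unfolding holds_def by (intro bexI[of _ "k - 1"]) simp
  qed
  have "card {M \<in> ?D. holds M b} =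
      card {M \<in> ?D. holds M a \<and> holds M b} + card {M \<in> ?D. \<not> holds M a \<and> holds M b}"
    by (subst card_Un_disjoint[symmetric]) (auto intro!: arg_cong[where f = card])
  also have "card {M \<in> ?D. \<not> holds M a \<and> holds M b} =
      card {M \<in> diagrams (r + 1/24 + of_int i). holds M (a - 1) \<and> holds M (b - 1)}"
  proof (cases "b \<in> half_ints")
    case True
    then obtain j where j: "b = of_int j + 1/2" by (auto simp: half_ints_def)
    then have "i \<noteq> j" using assms(2) i by auto
    from card_fill_and_lower[OF this, of "r + 1/24"] show ?thesis
      unfolding shift by (simp add: holds_def i j)
  next
    case False
    then have "\<not> holds M b" "\<not> holds M (b - 1)" for M
      unfolding shift by (auto simp: holds_def)
    then show ?thesis by simp
  qed
  finally show ?thesis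
    unfolding graded_trace_card by (simp add: i algebra_simps)
qed

text \<open>
  The exponents in \<open>\<eta>(q)\<close> are bounded below, and so are those in the trace since energies are non-negative.
  Hence the product with \<open>\<eta>(q)\<close> is a finite sum, and additive in the trace.
\<close>

lemma finite_G_coeff_terms:
  "finite {r. eta_coeff r * graded_trace 0 (foldr (\<circ>) (map o_XX as) id) (k - r) \<noteq> 0}"
proof (rule finite_subset)
  let ?R = "(\<lambda>n::nat. 1/24 + of_nat n :: rat) ` {..nat \<lfloor>k\<rfloor>}"
  show "{r. eta_coeff r * graded_trace 0 (foldr (\<circ>) (map o_XX as) id) (k - r) \<noteq> 0} \<subseteq> ?R"
  proof
    fix r assume "r \<in> {r. eta_coeff r * graded_trace 0 (foldr (\<circ>) (map o_XX as) id) (k - r) \<noteq> 0}"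
    then have eta: "eta_coeff r \<noteq> 0"
      and tr: "graded_trace 0 (foldr (\<circ>) (map o_XX as) id) (k - r) \<noteq> 0" by auto
    obtain n :: nat where n: "r = 1/24 + of_nat n"
    proof (rule ccontr)
      assume "\<not> thesis"
      then have "\<And>n :: nat. r \<noteq> 1/24 + of_nat n" using that by blast
      then show False using eta by (simp add: eta_coeff_def)
    qed
    have "{M \<in> diagrams (k - r + 1/24). \<forall>a\<in>set as. holds M a} \<noteq> {}"
      using tr unfolding graded_trace_card by (metis card.empty of_nat_0)
    then obtain M where "energy M = k - r + 1/24" by (auto simp: diagrams_def)
    then have "of_nat n \<le> k" using energy_nonneg[of M] n by simp
    then have "n \<le> nat \<lfloor>k\<rfloor>" by linarith
    then show "r \<in> ?R" using n by blast
  qed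
qed simp

lemma G_coeff_recursion:
  assumes "a \<in> half_ints" "a \<noteq> b"
  shows "G_coeff [b] k = G_coeff [a, b] k + G_coeff [a - 1, b - 1] (k + a - 1/2)"
proof -
  have "G_coeff [a - 1, b - 1] (k + a - 1/2) =
      Sum_any (\<lambda>r. eta_coeff r * graded_trace 0 (foldr (\<circ>) (map o_XX [a - 1, b - 1]) id) (k - r + a - 1/2))"
    unfolding G_coeff_def by (rule Sum_any.cong) (simp add: algebra_simps)
  moreover have "finite {r. eta_coeff r *
      graded_trace 0 (foldr (\<circ>) (map o_XX [a - 1, b - 1]) id) (k - r + a - 1/2) \<noteq> 0}"
    using finite_G_coeff_terms[of "[a - 1, b - 1]" "k + a - 1/2"]
    by (simp add: algebra_simps del: list.map foldr.simps)
  ultimately show ?thesis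
    unfolding G_coeff_def graded_trace_recursion[OF assms] distrib_left
    by (simp only: Sum_any.distrib finite_G_coeff_terms)
qed

lemma G_coeff_diagonal: "G_coeff [a, a] k = G_coeff [a] k"
  by (simp only: G_coeff_def graded_trace_card) simp

lemma G_coeff_nonhalf:
  assumes "a \<in> set as" "a \<notin> half_ints"
  shows "G_coeff as k = 0"
proof -
  have "\<not> holds M a" for M using assms(2) by (auto simp: holds_def)
  then have none: "{M \<in> D. \<forall>a\<in>set as. holds M a} = {}" for D using assms(1) by auto
  show ?thesis by (simp only: G_coeff_def graded_trace_card none) simp
qed

end

section \<open>Products and substitutions of formal series\<close>

text \<open>
  When the substituted monomials are multiplicatively independent of each other and of \<open>q\<close>, at most one
  term of \<open>F\<close> contributes to a given coefficient.
\<close>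

lemma subst_fs_unique:
  assumes "\<And>as k. length as = length ms \<and> (k, 0, 0) + sum_list (map2 scale_exp as ms) = e
    \<longleftrightarrow> as = as' \<and> k = k'"
  shows "subst_fs F ms e = F as' k'"
proof -
  have "subst_fs F ms e = Sum_any (\<lambda>p. if p = (as', k') then F as' k' else 0)"
    unfolding subst_fs_def by (rule Sum_any.cong) (auto simp: assms split: prod.split)
  then show ?thesis by simp
qed

lemma subst_fs_none:
  assumes "\<And>as k. length as = length ms \<Longrightarrow> (k, 0, 0) + sum_list (map2 scale_exp as ms) \<noteq> e"
  shows "subst_fs F ms e = 0"
proof -
  have "subst_fs F ms e = Sum_any (\<lambda>p :: rat list \<times> rat. 0)"
    unfolding subst_fs_def by (rule Sum_any.cong) (use assms in \<open>auto split: prod.split\<close>)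
  then show ?thesis by simp
qed

lemma subst_fs_qt1_t2: "subst_fs F [(1, 1, 0), (0, 0, 1)] (k, a, b) = F [a, b] (k - a)"
  by (rule subst_fs_unique) (auto simp: length_Suc_conv scale_exp_def zero_prod_def)

lemma subst_fs_t1_t2: "subst_fs F [(0, 1, 0), (0, 0, 1)] (k, a, b) = F [a, b] k"
  by (rule subst_fs_unique) (auto simp: length_Suc_conv scale_exp_def zero_prod_def)

lemma subst_fs_t2: "subst_fs F [(0, 0, 1)] (k, a, b) = (if a = 0 then F [b] k else 0)"
proof (cases "a = 0")
  case True
  have "subst_fs F [(0, 0, 1)] (k, a, b) = F [b] k"
    by (rule subst_fs_unique) (auto simp: length_Suc_conv scale_exp_def zero_prod_def True)
  then show ?thesis using True by simp
next
  case False
  have "subst_fs F [(0, 0, 1)] (k, a, b) = 0"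
    by (rule subst_fs_none) (use False in \<open>auto simp: length_Suc_conv scale_exp_def zero_prod_def\<close>)
  then show ?thesis using False by simp
qed

lemma subst_fs_t1t2: "subst_fs F [(0, 1, 1)] (k, a, b) = (if a = b then F [a] k else 0)"
proof (cases "a = b")
  case True
  have "subst_fs F [(0, 1, 1)] (k, a, b) = F [a] k"
    by (rule subst_fs_unique) (auto simp: length_Suc_conv scale_exp_def zero_prod_def True)
  then show ?thesis using True by simp
next
  case False
  have "subst_fs F [(0, 1, 1)] (k, a, b) = 0"
    by (rule subst_fs_none) (use False in \<open>auto simp: length_Suc_conv scale_exp_def zero_prod_def\<close>)
  then show ?thesis using False by simp
qed

lemma delta_half_qt1:
  "delta_half (1, 1, 0) (k, a, b) = of_bool (k = a \<and> b = 0 \<and> a \<in> half_ints)"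
proof (cases "b = 0")
  case True
  have "delta_half (1, 1, 0) (k, a, b) = delta_half_coeff [a] (k - a)"
    unfolding delta_half_def
    by (rule subst_fs_unique) (auto simp: length_Suc_conv scale_exp_def zero_prod_def True)
  then show ?thesis using True by (auto simp: delta_half_coeff_def)
next
  case False
  have "delta_half (1, 1, 0) (k, a, b) = 0"
    unfolding delta_half_def
    by (rule subst_fs_none) (use False in \<open>auto simp: length_Suc_conv scale_exp_def zero_prod_def\<close>)
  then show ?thesis using False by simp
qed

lemma fs_mult_single:
  assumes "\<And>d. d \<noteq> d' \<Longrightarrow> f d * g (e - d) = 0"
  shows "(f \<star> g) e = f d' * g (e - d')"
proof -
  have "(f \<star> g) e = Sum_any (\<lambda>d. if d = d' then f d' * g (e - d') else 0)"
    unfolding fs_mult_def by (rule Sum_any.cong) (use assms in auto)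
  then show ?thesis by simp
qed

lemma mono_fs_mult: "(mono_fs d \<star> f) e = f (e - d)"
  by (subst fs_mult_single[of d]) (auto simp: mono_fs_def)

lemma finite_mono_fs: "finite {d. mono_fs m d \<noteq> 0}"
  by (rule finite_subset[of _ "{m}"]) (auto simp: mono_fs_def)

lemma fs_mult_diff_left:
  assumes "finite {d. f d \<noteq> 0}" "finite {d. g d \<noteq> 0}"
  shows "((f - g) \<star> h) e = (f \<star> h) e - (g \<star> h) e"
proof -
  let ?D = "{d. f d \<noteq> 0} \<union> {d. g d \<noteq> 0}"
  have D: "finite ?D" using assms by simp
  have "(u \<star> h) e = (\<Sum>d\<in>?D. u d * h (e - d))" if "{d. u d \<noteq> 0} \<subseteq> ?D" for u :: fseries
    unfolding fs_mult_def using D that by (intro Sum_any.expand_superset) auto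
  note expand = this
  show ?thesis
    by (subst (1 2 3) expand) (auto simp: sum_subtractf[symmetric] left_diff_distrib)
qed

lemma finite_support_diff:
  fixes f g :: fseries
  assumes "finite {d. f d \<noteq> 0}" "finite {d. g d \<noteq> 0}"
  shows "finite {d. (f - g) d \<noteq> 0}"
  by (rule finite_subset[of _ "{d. f d \<noteq> 0} \<union> {d. g d \<noteq> 0}"]) (use assms in auto)

text \<open>
  Multiplication by \<open>(1 - z\<^sup>c)(1 - z\<^sup>d)\<close> is a composition of two difference operators.
\<close>

lemma binomials_mult:
  "((mono_fs 0 - mono_fs c) \<star> (mono_fs 0 - mono_fs d) \<star> f) e =
     (f e - f (e - d)) - (f (e - c) - f (e - c - d))"
proof -
  have "(mono_fs 0 - mono_fs c) \<star> (mono_fs 0 - mono_fs d) =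
      (mono_fs 0 - mono_fs d) - (mono_fs c - mono_fs (c + d))"
  proof
    fix e
    have "e - 0 = 0 \<longleftrightarrow> e = 0" "e - c = 0 \<longleftrightarrow> e = c" "e - c = d \<longleftrightarrow> e = c + d"
      by (auto simp: diff_eq_eq add.commute)
    then show "((mono_fs 0 - mono_fs c) \<star> (mono_fs 0 - mono_fs d)) e =
        ((mono_fs 0 - mono_fs d) - (mono_fs c - mono_fs (c + d))) e"
      by (simp add: fs_mult_diff_left finite_mono_fs mono_fs_mult) (simp add: mono_fs_def)
  qed
  then show ?thesis
    by (simp only: fs_mult_diff_left finite_support_diff finite_mono_fs mono_fs_mult
        diff_diff_eq[of e c d] diff_zero)
qed

theorem proposition3p4:
  fixes scale :: "complex \<Rightarrow> 'v::ab_group_add \<Rightarrow> 'v"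
    and psi psis :: "rat \<Rightarrow> 'v \<Rightarrow> 'v"
    and vac :: 'v
    and G :: "monomial list \<Rightarrow> fseries"
  assumes "charged_fermion_fock scale psi psis vac"
    and "G = charged_fermion_fock.G scale psi psis vac"
  shows
    "G [(1, 1, 0), (0, 0, 1)] + mono_fs (1/2, 1, 1) \<star> G [(0, 1, 0), (0, 0, 1)] =
       delta_half (1, 1, 0) \<star> G [(0, 0, 1)] + mono_fs (1/2, 1, 1) \<star> G [(0, 1, 1)]
     \<and>
     (mono_fs (0, 0, 0) - mono_fs (1, 1, 1)) \<star> (mono_fs (0, 0, 0) - mono_fs (1, 1, 0)) \<star>
       (G [(1, 1, 0), (0, 0, 1)] + mono_fs (1/2, 1, 1) \<star> G [(0, 1, 0), (0, 0, 1)]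
         - mono_fs (1/2, 1, 1) \<star> G [(0, 1, 1)]) = 0"
proof -
  interpret charged_fermion_fock scale psi psis vac by (rule assms(1))
  define c where "c = charged_fermion_fock.G_coeff scale psi psis vac"
  have G: "G ms = subst_fs c ms" for ms by (simp add: assms(2) G_def c_def)
  have recursion: "c [b] k = c [a, b] k + c [a - 1, b - 1] (k + a - 1/2)"
    if "a \<in> half_ints" "a \<noteq> b" for a b k
    unfolding c_def by (rule G_coeff_recursion[OF that])
  have diagonal: "c [a, a] k = c [a] k" for a k
    unfolding c_def by (rule G_coeff_diagonal)
  have nonhalf: "c (a # as) k = 0" if "a \<notin> half_ints" for a as k
    unfolding c_def by (rule G_coeff_nonhalf[of a]) (use that in auto)
  have delta: "(delta_half (1, 1, 0) \<star> G [(0, 0, 1)]) (k, a, b) = (if a \<in> half_ints then c [b] (k - a) else 0)"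
    for k a b
    by (subst fs_mult_single[of "(a, a, 0)"])
      (auto simp: delta_half_qt1 G subst_fs_t2 of_bool_def split: if_splits)
  (* For a = b the recursion is not available, and the term G(t1 t2) compensates for it. *)
  have coeff: "(G [(1, 1, 0), (0, 0, 1)] + mono_fs (1/2, 1, 1) \<star> G [(0, 1, 0), (0, 0, 1)]) (k, a, b) =
      (delta_half (1, 1, 0) \<star> G [(0, 0, 1)] + mono_fs (1/2, 1, 1) \<star> G [(0, 1, 1)]) (k, a, b)" for k a b
  proof -
    have "c [a, b] (k - a) + c [a - 1, b - 1] (k - 1/2) =
        (if a \<in> half_ints then c [b] (k - a) else 0) + (if a = b then c [a - 1] (k - 1/2) else 0)"
    proof (cases "a \<in> half_ints")
      case True
      then show ?thesis using recursion[of a b "k - a"] diagonal by auto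
    next
      case False
      then show ?thesis by (auto simp: nonhalf half_ints_minus_1)
    qed
    then show ?thesis
      by (simp add: delta mono_fs_mult) (simp add: G subst_fs_qt1_t2 subst_fs_t1_t2 subst_fs_t1t2)
  qed
  then have eq: "G [(1, 1, 0), (0, 0, 1)] + mono_fs (1/2, 1, 1) \<star> G [(0, 1, 0), (0, 0, 1)] =
      delta_half (1, 1, 0) \<star> G [(0, 0, 1)] + mono_fs (1/2, 1, 1) \<star> G [(0, 1, 1)]"
    by (intro ext) auto
  define D where "D = delta_half (1, 1, 0) \<star> G [(0, 0, 1)]"
  (* Multiplication by q t1 leaves the series D unchanged, so that 1 - q t1 kills it. *)
  have periodic: "D (e - (1, 1, 0)) = D e" for e
  proof (cases e)
    case (fields k a b)
    show ?thesis by (simp add: fields D_def delta half_ints_minus_1)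
  qed
  have "(mono_fs (0, 0, 0) - mono_fs (1, 1, 1)) \<star> (mono_fs (0, 0, 0) - mono_fs (1, 1, 0)) \<star> D = 0"
    using binomials_mult[of "(1, 1, 1)" "(1, 1, 0)" D]
    by (intro ext) (simp add: zero_prod_def periodic)
  with eq show ?thesis by (simp add: D_def)
qed

end
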